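(* Let $B$ be a unital Banach algebra over $\mathbb{C}$ and $\theta\in B^d$ with $\theta(1)=1$. The sequence of linear maps $$0\to\mathcal{Z}(1^\perp)+[\mathcal{Z}(B^d),\mathcal{Z}(B^d)]\to\mathcal{Z}(B^d)\xrightarrow{\ D|_{\mathcal{Z}(B^d)}\ }\mathcal{Z}(B^d)\xrightarrow{\ \Theta_{\mathcal{Z}(B^d)}\ }\mathcal{Z}(B^d),$$ whose first nontrivial map is the inclusion, is exact.
   Context: $B^d$ is the topological dual of $B$; $M_n(B)=M_n(\mathbb{C})\otimes B$ with its natural topology; $M(B)=(M_n(B))_{n\ge1}$. $A(M(B))$ is the unital algebra (levelwise operations) of families $f=(f_n)_{n\ge1}$ of analytic maps $f_n:M_n(B)\to M_n(\mathbb{C})$ with $f_{m+n}(\beta\oplus\beta')=f_m(\beta)\oplus f_n(\beta')$ and $f_n((s\otimes1)\beta(s\otimes1)^{-1})=sf_n(\beta)s^{-1}$ for $s\in GL_n(\mathbb{C})$. For $\varphi\in B^d$, $z(\varphi)\in A(M(B))$ is $z(\varphi)_n=\mathrm{id}_{M_n(\mathbb{C})}\otimes\varphi$ (apply $\varphi$ entrywise). $\mathcal{Z}(B^d)$ is the unital subalgebra of $A(M(B))$ generated by $\{z(\varphi):\varphi\in B^d\}$, and $\mathcal{Z}(1^\perp)$ the unital subalgebra generated by $\{z(\varphi):\varphi\in B^d,\ \varphi(1)=0\}$; $[\mathcal{Z}(B^d),\mathcal{Z}(B^d)]$ is the linear span of commutators. By a result of Voiculescu, $\mathcal{Z}(1^\perp)$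 and $z(\theta)$ are algebraically free and $\mathcal{Z}(B^d)=\mathcal{Z}(1^\perp)\langle z(\theta)\rangle$ is the algebraic free product of $\mathcal{Z}(1^\perp)$ with the polynomial algebra in $z(\theta)$; hence $\mathcal{Z}(B^d)$ is spanned by monomials $c_0z(\theta)c_1\cdots z(\theta)c_n$ with $c_i\in\mathcal{Z}(1^\perp)$, and there is a well-defined linear map $\rho$ on $\mathcal{Z}(B^d)$ with $\rho[c_0z(\theta)c_1\cdots z(\theta)c_n]=c_1z(\theta)c_2\cdots z(\theta)c_nz(\theta)c_0$. Put $\Theta_{\mathcal{Z}(B^d)}=\mathrm{id}-\rho$. The cyclic derivative $D$ on $A(M(B))$ is $(Df)_n(\beta)=\mathrm{mult}(\sigma((\partial f)_{n;n}(\beta;\beta)))$ with $\sigma(a\otimes b)=b\otimes a$, $\mathrm{mult}(a\otimes b)=ab$, and $$(\partial f)_{m;n}(\beta;\beta')=\sum_{1\le a,b\le m,\,1\le c,d\le n}\Big(\tfrac{d}{d\epsilon}f_{m+n}\big(\left[\begin{smallmatrix}\beta&\epsilon e^{(m,n)}_{b,c}\otimes1\\0&\beta'\end{smallmatrix}\right]\big)\big|_{\epsilon=0}\Big)_{(a,m+d)}e^{(m)}_{a,b}\otimes e^{(n)}_{c,d}$$ ($e$'s are matrix units). On monomials, $D[z(\varphi_1)\cdots z(\varphi_k)]=\sum_{i=1}^k\varphi_i(1)z(\varphi_{i+1})\cdots z(\varphi_k)z(\varphi_1)\cdots z(\varphi_{i-1})$, so $D$ maps $\mathcal{Z}(B^d)$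 into itself. *)

theory Defs
  imports "HOL-Analysis.Derivative" "Jordan_Normal_Form.Matrix"
begin

subsection \<open>Complex algebras and unital complex Banach algebras\<close>

class complex_vector = ab_group_add +
  fixes scaleC :: "complex \<Rightarrow> 'a \<Rightarrow> 'a" (infixr \<open>*\<^sub>C\<close> 75)
  assumes scaleC_add_right: "c *\<^sub>C (x + y) = c *\<^sub>C x + c *\<^sub>C y"
    and scaleC_add_left: "(c + d) *\<^sub>C x = c *\<^sub>C x + d *\<^sub>C x"
    and scaleC_scaleC: "c *\<^sub>C (d *\<^sub>C x) = (c * d) *\<^sub>C x"
    and scaleC_one: "1 *\<^sub>C x = x"

global_interpretation complex_vector:
  vector_space "scaleC :: complex \<Rightarrow> 'a \<Rightarrow> 'a::complex_vector"
  by unfold_locales (simp_all add: scaleC_add_right scaleC_add_left scaleC_scaleC scaleC_one)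

class complex_algebra_1 = complex_vector + ring_1 +
  assumes mult_scaleC_left: "(c *\<^sub>C x) * y = c *\<^sub>C (x * y)"
    and mult_scaleC_right: "x * (c *\<^sub>C y) = c *\<^sub>C (x * y)"

text \<open>The norm is complete and submultiplicative; \<open>norm 1 = 1\<close> is not required.\<close>

class complex_banach_algebra_1 =
  complex_algebra_1 + real_algebra_1 + real_normed_algebra + banach +
  assumes scaleR_scaleC: "r *\<^sub>R x = complex_of_real r *\<^sub>C x"
    and norm_scaleC: "norm (c *\<^sub>C x) = cmod c * norm x"

definition cdual :: "('b::complex_banach_algebra_1 \<Rightarrow> complex) set" where
  "cdual = {\<phi>. bounded_linear \<phi> \<and> (\<forall>c x. \<phi> (c *\<^sub>C x) = c * \<phi> x)}"

definition csubalgebra :: "'a::complex_algebra_1 set \<Rightarrow> bool" where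
  "csubalgebra S \<longleftrightarrow>
     complex_vector.subspace S \<and> 1 \<in> S \<and> (\<forall>x\<in>S. \<forall>y\<in>S. x * y \<in> S)"

definition commutator_span :: "'a::complex_algebra_1 set \<Rightarrow> 'a set" where
  "commutator_span S = complex_vector.span {x * y - y * x | x y. x \<in> S \<and> y \<in> S}"

definition clinear_on ::
    "'a::complex_vector set \<Rightarrow> 'b::complex_vector set \<Rightarrow> ('a \<Rightarrow> 'b) \<Rightarrow> bool" where
  "clinear_on S T h \<longleftrightarrow>
     complex_vector.subspace S \<and> complex_vector.subspace T \<and> h \<in> S \<rightarrow> T \<and>
     (\<forall>x\<in>S. \<forall>y\<in>S. h (x + y) = h x + h y) \<and> (\<forall>c. \<forall>x\<in>S. h (c *\<^sub>C x) = c *\<^sub>C h x)"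

definition kernel_on :: "'a set \<Rightarrow> ('a \<Rightarrow> 'b::zero) \<Rightarrow> 'a set" where
  "kernel_on S h = {x \<in> S. h x = 0}"


subsection \<open>The algebra of all families of matrix-valued maps\<close>

text \<open>
  An element is a family of maps \<open>f\<^sub>n\<close> from \<open>M\<^sub>n(B)\<close> to \<open>M\<^sub>n(\<complex>)\<close> for \<open>n \<ge> 1\<close>, where \<open>M\<^sub>n(B)\<close> is
  \<open>carrier_mat n n\<close>.  Outside the domain (including \<open>n = 0\<close>) the value is normalised to the zero
  matrix, so that equality of elements is equality on all \<open>M\<^sub>n(B)\<close>, \<open>n \<ge> 1\<close>.
\<close>

typedef 'b matfam =
  "{f :: nat \<Rightarrow> 'b mat \<Rightarrow> complex mat.
     (\<forall>n \<beta>. f n \<beta> \<in> carrier_mat n n) \<and>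
     (\<forall>n \<beta>. \<not> (0 < n \<and> \<beta> \<in> carrier_mat n n) \<longrightarrow> f n \<beta> = 0\<^sub>m n n)}"
  morphisms fam_app Abs_matfam
  by (rule exI[of _ "\<lambda>n _. 0\<^sub>m n n"]) auto

setup_lifting type_definition_matfam

lemma one_mat_neq_zero_mat: "1\<^sub>m (Suc 0) \<noteq> (0\<^sub>m (Suc 0) (Suc 0) :: complex mat)"
  by (metis One_nat_def index_one_mat(1) index_zero_mat(1) lessI zero_neq_one)

instantiation matfam :: (type) complex_algebra_1
begin

lift_definition zero_matfam :: "'a matfam" is "\<lambda>n \<beta>. 0\<^sub>m n n" by auto

lift_definition one_matfam :: "'a matfam" is
  "\<lambda>n \<beta>. if 0 < n \<and> \<beta> \<in> carrier_mat n n then 1\<^sub>m n else 0\<^sub>m n n" by auto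

lift_definition plus_matfam :: "'a matfam \<Rightarrow> 'a matfam \<Rightarrow> 'a matfam" is
  "\<lambda>f g n \<beta>. f n \<beta> + g n \<beta>" by auto

lift_definition minus_matfam :: "'a matfam \<Rightarrow> 'a matfam \<Rightarrow> 'a matfam" is
  "\<lambda>f g n \<beta>. f n \<beta> - g n \<beta>" by (auto intro!: minus_carrier_mat)

lift_definition uminus_matfam :: "'a matfam \<Rightarrow> 'a matfam" is
  "\<lambda>f n \<beta>. - f n \<beta>" by auto

lift_definition times_matfam :: "'a matfam \<Rightarrow> 'a matfam \<Rightarrow> 'a matfam" is
  "\<lambda>f g n \<beta>. f n \<beta> * g n \<beta>" by (auto intro!: mult_carrier_mat)

lift_definition scaleC_matfam :: "complex \<Rightarrow> 'a matfam \<Rightarrow> 'a matfam" is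
  "\<lambda>c f n \<beta>. c \<cdot>\<^sub>m f n \<beta>" by auto

instance
proof
  fix f g h :: "'a matfam" and c d :: complex
  have car: "fam_app k n \<beta> \<in> carrier_mat n n" for k :: "'a matfam" and n \<beta>
    using fam_app[of k] by blast
  have zer: "fam_app k n \<beta> = 0\<^sub>m n n" if "\<not> (0 < n \<and> \<beta> \<in> carrier_mat n n)"
    for k :: "'a matfam" and n \<beta>
    using fam_app[of k] that by blast
  have eqI: "k = l" if "\<And>n \<beta>. fam_app k n \<beta> = fam_app l n \<beta>" for k l :: "'a matfam"
    using that by (simp add: fam_app_inject[symmetric] fun_eq_iff)
  note rep = plus_matfam.rep_eq minus_matfam.rep_eq uminus_matfam.rep_eq times_matfam.rep_eq
    zero_matfam.rep_eq one_matfam.rep_eq scaleC_matfam.rep_eq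
  show "f + g + h = f + (g + h)"
    by (rule eqI) (simp add: rep assoc_add_mat[OF car car car])
  show "f + g = g + f"
    by (rule eqI) (simp add: rep comm_add_mat[OF car car])
  show "0 + f = f"
    by (rule eqI) (simp add: rep left_add_zero_mat[OF car])
  show "- f + f = 0"
    by (rule eqI) (simp add: rep uminus_l_inv_mat[OF car])
  show "f - g = f + - g"
    by (rule eqI) (simp add: rep minus_add_uminus_mat[OF car car])
  show "c *\<^sub>C (f + g) = c *\<^sub>C f + c *\<^sub>C g"
    by (rule eqI) (simp add: rep add_smult_distrib_left_mat[OF car car])
  show "(c + d) *\<^sub>C f = c *\<^sub>C f + d *\<^sub>C f"
    by (rule eqI) (simp add: rep add_smult_distrib_right_mat[OF car])
  show "c *\<^sub>C (d *\<^sub>C f) = (c * d) *\<^sub>C f"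
    by (rule eqI) (auto simp: rep)
  show "1 *\<^sub>C f = f"
    by (rule eqI) (auto simp: rep)
  show "f * g * h = f * (g * h)"
    by (rule eqI) (simp add: rep assoc_mult_mat[OF car car car])
  show "1 * f = f"
  proof (rule eqI)
    fix n \<beta>
    show "fam_app (1 * f) n \<beta> = fam_app f n \<beta>"
      using car[of f n \<beta>] by (auto simp: rep zer)
  qed
  show "f * 1 = f"
  proof (rule eqI)
    fix n \<beta>
    show "fam_app (f * 1) n \<beta> = fam_app f n \<beta>"
      using car[of f n \<beta>] by (auto simp: rep zer)
  qed
  show "(f + g) * h = f * h + g * h"
    by (rule eqI) (simp add: rep add_mult_distrib_mat[OF car car car])
  show "f * (g + h) = f * g + f * h"
    by (rule eqI) (simp add: rep mult_add_distrib_mat[OF car car car])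
  show "(c *\<^sub>C f) * g = c *\<^sub>C (f * g)"
    by (rule eqI) (simp add: rep mult_smult_assoc_mat[OF car car])
  show "f * (c *\<^sub>C g) = c *\<^sub>C (f * g)"
    by (rule eqI) (simp add: rep mult_smult_distrib[OF car car])
  show "(0 :: 'a matfam) \<noteq> 1"
  proof
    assume "(0 :: 'a matfam) = 1"
    then have "fam_app (0 :: 'a matfam) 1 (mat 1 1 undefined) = fam_app 1 1 (mat 1 1 undefined)"
      by simp
    then show False
      using one_mat_neq_zero_mat by (simp add: rep)
  qed
qed

end


subsection \<open>Analytic fully matricial families\<close>

text \<open>
  The natural topology of \<open>M\<^sub>n(B) = B\<^bsup>n\<times>n\<^esup>\<close> is the product topology, given for instance by the
  following norm.
\<close>

definition mat_norm1 :: "'b::real_normed_vector mat \<Rightarrow> real" where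
  "mat_norm1 A = (\<Sum>i<dim_row A. \<Sum>j<dim_col A. norm (A $$ (i, j)))"

definition bounded_clinear_mat ::
    "nat \<Rightarrow> ('b::complex_banach_algebra_1 mat \<Rightarrow> complex mat) \<Rightarrow> bool" where
  "bounded_clinear_mat n L \<longleftrightarrow>
     L \<in> carrier_mat n n \<rightarrow> carrier_mat n n \<and>
     (\<forall>H\<in>carrier_mat n n. \<forall>K\<in>carrier_mat n n. L (H + K) = L H + L K) \<and>
     (\<forall>c. \<forall>H\<in>carrier_mat n n. L (map_mat (scaleC c) H) = c \<cdot>\<^sub>m L H) \<and>
     (\<exists>K. \<forall>H\<in>carrier_mat n n. mat_norm1 (L H) \<le> K * mat_norm1 H)"

text \<open>
  As in the case of \<open>analytic_on\<close>, analyticity means complex differentiability (here: Frechet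
  differentiability with complex-linear derivative) at every point of the open domain.
\<close>

definition analytic_mat ::
    "nat \<Rightarrow> ('b::complex_banach_algebra_1 mat \<Rightarrow> complex mat) \<Rightarrow> bool" where
  "analytic_mat n g \<longleftrightarrow>
     (\<forall>\<beta>\<in>carrier_mat n n. \<exists>L. bounded_clinear_mat n L \<and>
        (\<forall>e>0. \<exists>d>0. \<forall>H\<in>carrier_mat n n. mat_norm1 H < d \<longrightarrow>
            mat_norm1 (g (\<beta> + H) - g \<beta> - L H) \<le> e * mat_norm1 H))"

definition dirsum_mat :: "'a::zero mat \<Rightarrow> 'a mat \<Rightarrow> 'a mat" where
  "dirsum_mat X Y =
     four_block_mat X (0\<^sub>m (dim_row X) (dim_col Y)) (0\<^sub>m (dim_row Y) (dim_col X)) Y"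

text \<open>\<open>s \<otimes> 1\<close> for a scalar matrix \<open>s\<close>.\<close>

definition tensor_one :: "complex mat \<Rightarrow> 'b::complex_banach_algebra_1 mat" where
  "tensor_one s = map_mat (\<lambda>c. c *\<^sub>C 1) s"

definition A_MB :: "'b::complex_banach_algebra_1 matfam set" where
  "A_MB = {f.
     (\<forall>n>0. analytic_mat n (fam_app f n)) \<and>
     (\<forall>m>0. \<forall>n>0. \<forall>\<beta>\<in>carrier_mat m m. \<forall>\<beta>'\<in>carrier_mat n n.
        fam_app f (m + n) (dirsum_mat \<beta> \<beta>') = dirsum_mat (fam_app f m \<beta>) (fam_app f n \<beta>')) \<and>
     (\<forall>n>0. \<forall>\<beta>\<in>carrier_mat n n. \<forall>s\<in>carrier_mat n n. \<forall>s'\<in>carrier_mat n n.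
        inverts_mat s s' \<and> inverts_mat s' s \<longrightarrow>
        fam_app f n (tensor_one s * \<beta> * tensor_one s') = s * fam_app f n \<beta> * s')}"

lift_definition zgen :: "('b \<Rightarrow> complex) \<Rightarrow> 'b matfam" is
  "\<lambda>\<phi> n \<beta>. if 0 < n \<and> \<beta> \<in> carrier_mat n n then map_mat \<phi> \<beta> else 0\<^sub>m n n" by auto

definition Z_dual :: "'b::complex_banach_algebra_1 matfam set" where
  "Z_dual = (\<lambda>S. csubalgebra S \<and> S \<subseteq> A_MB) hull (zgen ` cdual)"

definition Z_one_perp :: "'b::complex_banach_algebra_1 matfam set" where
  "Z_one_perp = (\<lambda>S. csubalgebra S \<and> S \<subseteq> A_MB) hull (zgen ` {\<phi> \<in> cdual. \<phi> 1 = 0})"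


subsection \<open>The cyclic derivative\<close>

definition mat_unit :: "nat \<Rightarrow> nat \<Rightarrow> nat \<Rightarrow> nat \<Rightarrow> 'a::zero_neq_one mat" where
  "mat_unit m n i j = mat m n (\<lambda>(k, l). if k = i \<and> l = j then 1 else 0)"

text \<open>
  Matrix indices start at \<open>0\<close>.  An element
  \<open>\<Sum> t a b c d e\<^sub>a\<^sub>b \<otimes> e\<^sub>c\<^sub>d\<close> of \<open>M\<^sub>m(\<complex>) \<otimes> M\<^sub>n(\<complex>)\<close> (\<open>a, b < m\<close> and \<open>c, d < n\<close>) is represented by its
  coefficient function \<open>t\<close>.
\<close>

type_synonym mat_tensor = "nat \<Rightarrow> nat \<Rightarrow> nat \<Rightarrow> nat \<Rightarrow> complex"

definition fdq :: "'b::complex_banach_algebra_1 matfam \<Rightarrow> nat \<Rightarrow> nat \<Rightarrow> 'b mat \<Rightarrow> 'b mat \<Rightarrow> mat_tensor"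
  where
  "fdq f m n \<beta> \<beta>' = (\<lambda>a b c d.
     deriv (\<lambda>\<epsilon>. fam_app f (m + n)
              (four_block_mat \<beta> (map_mat (scaleC \<epsilon>) (mat_unit m n b c)) (0\<^sub>m n m) \<beta>') $$ (a, m + d)) 0)"

definition tensor_flip :: "mat_tensor \<Rightarrow> mat_tensor" where
  "tensor_flip t = (\<lambda>a b c d. t c d a b)"

definition tensor_mult :: "nat \<Rightarrow> mat_tensor \<Rightarrow> complex mat" where
  "tensor_mult n t = mat n n (\<lambda>(i, j).
     \<Sum>a<n. \<Sum>b<n. \<Sum>c<n. \<Sum>d<n. t a b c d * (mat_unit n n a b * mat_unit n n c d) $$ (i, j))"

lift_definition cyc_deriv :: "'b::complex_banach_algebra_1 matfam \<Rightarrow> 'b matfam" is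
  "\<lambda>f n \<beta>. if 0 < n \<and> \<beta> \<in> carrier_mat n n
            then tensor_mult n (tensor_flip (fdq f n n \<beta> \<beta>)) else 0\<^sub>m n n"
  by (auto simp: tensor_mult_def)


subsection \<open>The map \<open>\<Theta>\<close>\<close>

text \<open>\<open>alt_monomial t [c\<^sub>0, \<dots>, c\<^sub>n] = c\<^sub>0 t c\<^sub>1 \<cdots> t c\<^sub>n\<close>\<close>

fun alt_monomial :: "'a::monoid_mult \<Rightarrow> 'a list \<Rightarrow> 'a" where
  "alt_monomial t [] = 1"
| "alt_monomial t [c] = c"
| "alt_monomial t (c # d # cs) = c * t * alt_monomial t (d # cs)"

text \<open>
  \<open>\<rho>\<close> rotates the coefficients cyclically; in particular \<open>\<rho> c\<^sub>0 = c\<^sub>0\<close> for monomials without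
  \<open>z(\<theta>)\<close>.  Outside \<open>Z_dual\<close> its value is fixed to be \<open>0\<close>.
\<close>

definition rho_map ::
    "('b::complex_banach_algebra_1 \<Rightarrow> complex) \<Rightarrow> 'b matfam \<Rightarrow> 'b matfam" where
  "rho_map \<theta> = (THE \<rho>.
     clinear_on Z_dual Z_dual \<rho> \<and>
     (\<forall>c\<^sub>0\<in>Z_one_perp. \<forall>cs\<in>lists Z_one_perp.
        \<rho> (alt_monomial (zgen \<theta>) (c\<^sub>0 # cs)) = alt_monomial (zgen \<theta>) (cs @ [c\<^sub>0])) \<and>
     (\<forall>f. f \<notin> Z_dual \<longrightarrow> \<rho> f = 0))"

definition Theta_map ::
    "('b::complex_banach_algebra_1 \<Rightarrow> complex) \<Rightarrow> 'b matfam \<Rightarrow> 'b matfam" where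
  "Theta_map \<theta> f = f - rho_map \<theta> f"

end

theory Submission
  imports Defs
begin

text \<open>
  Write \<open>t\<close> for \<open>zgen \<theta>\<close> and \<open>C\<close> for \<open>Z_one_perp\<close>.  Since \<open>\<phi> = (\<phi> - \<phi>(1)\<theta>) + \<phi>(1)\<theta>\<close>, the algebra
  \<open>Z_dual\<close> is spanned by the monomials \<open>c\<^sub>0 t c\<^sub>1 \<cdots> t c\<^sub>n\<close> with \<open>c\<^sub>i \<in> C\<close>; let \<open>Z\<^sub>n\<close> be the span of those
  with \<open>n\<close> factors \<open>t\<close>.  On monomials the claims are combinatorics of cyclic words:

  \<^item> the cyclic derivative \<open>D\<close> vanishes on \<open>C\<close> and on commutators, and
    \<open>D(t c\<^sub>1 t c\<^sub>2 \<cdots> t c\<^sub>n)\<close> is the sum of the \<open>n\<close> cyclic rotations of \<open>c\<^sub>1 t c\<^sub>2 \<cdots> t c\<^sub>n\<close>;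
  \<^item> hence \<open>t D(f) - n f\<close> is a sum of commutators for \<open>f \<in> Z\<^sub>n\<close> (\<open>t_mult_der_diff_in_Comm\<close>), which
    gives the kernel of \<open>D\<close>;
  \<^item> the values of \<open>D\<close> on \<open>Z_dual\<close> are fixed by \<open>\<rho>\<close> (\<open>rot_der\<close>), and \<open>D(t f) = \<Sum>k\<le>n. \<rho>\<^sup>k f\<close> for \<open>f \<in> Z\<^sub>n\<close>
    (\<open>der_t_mult\<close>), which is \<open>(n + 1) f\<close> if \<open>\<rho> f = f\<close>; this gives the kernel of \<open>id - \<rho>\<close>.

  Both kernel computations are done degree by degree, so they need that the sum of the \<open>Z\<^sub>n\<close> is
  direct, and the statement itself needs that \<open>\<rho>\<close> is well defined.  These two consequences of the
  freeness of \<open>C\<close> and \<open>t\<close> are obtained directly from evaluations at matrices, without choosing bases.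
  For a scalar \<open>\<mu>\<close> let \<open>\<beta>\<^sub>\<mu> = \<beta> + (\<mu> - 1) \<theta>(\<beta>) \<otimes> 1\<close>.  The substitution \<open>f \<mapsto> f(\<beta>\<^sub>\<mu>)\<close> (\<open>dilate\<close>) is an
  algebra endomorphism that fixes \<open>C\<close> and sends \<open>t\<close> to \<open>\<mu> t\<close>, so it acts on \<open>Z\<^sub>n\<close> as \<open>\<mu>\<^sup>n\<close>; comparing
  coefficients of polynomials in \<open>\<mu>\<close> separates the degrees (\<open>hom_part_independent\<close>).

  Let \<open>\<partial>f(\<beta>, \<beta>')(X)\<close> be the upper right block of \<open>f\<close> at the block matrix with diagonal \<open>\<beta>, \<beta>'\<close> and
  upper right entry \<open>X \<otimes> 1\<close>.  The twisted cyclic derivative \<open>L\<^sub>\<mu>(f | h)\<close> (\<open>twisted_deriv\<close>) is determined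
  by \<open>tr (L\<^sub>\<mu>(f | h)(\<beta>) X) = tr (\<partial>f(\<beta>\<^sub>\<mu>, \<beta>)(X) h(\<beta>))\<close>, and the Leibniz rule for \<open>\<partial>\<close> becomes
  \<open>L\<^sub>\<mu>(f g | h) = L\<^sub>\<mu>(f | g h) + L\<^sub>\<mu>(g | h f(\<beta>\<^sub>\<mu>))\<close> with \<open>L\<^sub>\<mu>(zgen \<phi> | h) = \<phi>(1) h\<close>.  For \<open>\<mu> = 1\<close> and \<open>h = 1\<close>
  this is \<open>D\<close>.  For \<open>\<mu> = 0\<close> the factor \<open>f(\<beta>\<^sub>0)\<close> kills every term but the one at the first \<open>t\<close>, so
  \<open>L\<^sub>0(c\<^sub>0 t c\<^sub>1 \<cdots> t c\<^sub>n | t) = c\<^sub>1 t \<cdots> t c\<^sub>n t c\<^sub>0\<close> for \<open>n \<ge> 1\<close>, and \<open>f \<mapsto> L\<^sub>0(f | t) + f(\<beta>\<^sub>0)\<close> is a globally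
  defined linear map that restricts to \<open>\<rho>\<close> (\<open>rot_alt_monomial\<close>).

  That \<open>Z_dual\<close> and \<open>Z_one_perp\<close> are the generated algebras depends on \<open>A_MB\<close> being itself an algebra
  that contains the generators; the product rule for the Frechet derivative is the main point there.
\<close>

section \<open>Families of matrix-valued maps\<close>

lemma fam_app_carrier [simp]: "fam_app f n \<beta> \<in> carrier_mat n n"
  using fam_app[of f] by blast

lemma fam_app_dim [simp]: "dim_row (fam_app f n \<beta>) = n" "dim_col (fam_app f n \<beta>) = n"
  using fam_app_carrier[of f n \<beta>] by (auto simp del: fam_app_carrier)

lemma fam_app_outside: "\<not> (0 < n \<and> \<beta> \<in> carrier_mat n n) \<Longrightarrow> fam_app f n \<beta> = 0\<^sub>m n n"
  using fam_app[of f] by blast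

lemma matfam_eqI:
  assumes "\<And>n \<beta>. 0 < n \<Longrightarrow> \<beta> \<in> carrier_mat n n \<Longrightarrow> fam_app f n \<beta> = fam_app g n \<beta>"
  shows "f = g"
proof -
  have "fam_app f n \<beta> = fam_app g n \<beta>" for n \<beta>
    using assms fam_app_outside[of n \<beta> f] fam_app_outside[of n \<beta> g] by metis
  then show ?thesis by (simp add: fam_app_inject[symmetric] fun_eq_iff)
qed

lemmas fam_app_simps = plus_matfam.rep_eq minus_matfam.rep_eq uminus_matfam.rep_eq
  times_matfam.rep_eq zero_matfam.rep_eq one_matfam.rep_eq scaleC_matfam.rep_eq

section \<open>Analytic fully matricial families form a subalgebra\<close>

lemma mat_norm1_nonneg: "0 \<le> mat_norm1 A"
  by (simp add: mat_norm1_def sum_nonneg)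

lemma mat_norm1_zero [simp]: "mat_norm1 (0\<^sub>m n n) = 0"
  by (simp add: mat_norm1_def)

lemma mat_norm1_add_le:
  assumes "A \<in> carrier_mat n n" "B \<in> carrier_mat n n"
  shows "mat_norm1 (A + B) \<le> mat_norm1 A + mat_norm1 B"
  using assms by (auto simp: mat_norm1_def sum.distrib[symmetric] intro!: sum_mono norm_triangle_ineq)

lemma mat_norm1_mult_le:
  fixes A B :: "complex mat"
  assumes "A \<in> carrier_mat n n" "B \<in> carrier_mat n n"
  shows "mat_norm1 (A * B) \<le> mat_norm1 A * mat_norm1 B"
proof -
  have "mat_norm1 (A * B) = (\<Sum>i<n. \<Sum>j<n. cmod (\<Sum>k<n. A $$ (i, k) * B $$ (k, j)))"
    using assms by (simp add: mat_norm1_def scalar_prod_def atLeast0LessThan)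
  also have "\<dots> \<le> (\<Sum>i<n. \<Sum>j<n. \<Sum>k<n. cmod (A $$ (i, k)) * cmod (B $$ (k, j)))"
    by (intro sum_mono norm_sum[THEN order_trans]) (simp add: norm_mult)
  also have "\<dots> = (\<Sum>i<n. \<Sum>k<n. cmod (A $$ (i, k)) * (\<Sum>j<n. cmod (B $$ (k, j))))"
    unfolding sum_distrib_left by (intro sum.cong refl sum.swap)
  also have "\<dots> \<le> (\<Sum>i<n. \<Sum>k<n. cmod (A $$ (i, k)) * mat_norm1 B)"
    using assms
    by (intro sum_mono mult_left_mono)
      (auto simp: mat_norm1_def intro!: member_le_sum[where f = "\<lambda>k. \<Sum>j<n. cmod (B $$ (k, j))"] sum_nonneg)
  also have "\<dots> = mat_norm1 A * mat_norm1 B"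
    using assms by (simp add: mat_norm1_def sum_distrib_right)
  finally show ?thesis .
qed

text \<open>\<open>L\<close> is the Frechet derivative of \<open>g\<close> at \<open>\<beta>\<close>.\<close>

definition has_mat_derivative ::
    "nat \<Rightarrow> ('b::complex_banach_algebra_1 mat \<Rightarrow> complex mat) \<Rightarrow> 'b mat \<Rightarrow>
      ('b mat \<Rightarrow> complex mat) \<Rightarrow> bool" where
  "has_mat_derivative n g \<beta> L \<longleftrightarrow> bounded_clinear_mat n L \<and>
     (\<forall>e>0. \<exists>d>0. \<forall>H\<in>carrier_mat n n. mat_norm1 H < d \<longrightarrow>
        mat_norm1 (g (\<beta> + H) - g \<beta> - L H) \<le> e * mat_norm1 H)"

lemma analytic_mat_iff:
  "analytic_mat n g \<longleftrightarrow> (\<forall>\<beta>\<in>carrier_mat n n. \<exists>L. has_mat_derivative n g \<beta> L)"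
  by (simp add: analytic_mat_def has_mat_derivative_def)

lemma bounded_clinear_matE:
  assumes "bounded_clinear_mat n L"
  obtains K where "K \<ge> 0" "\<And>H. H \<in> carrier_mat n n \<Longrightarrow> mat_norm1 (L H) \<le> K * mat_norm1 H"
proof -
  obtain K where K: "\<And>H. H \<in> carrier_mat n n \<Longrightarrow> mat_norm1 (L H) \<le> K * mat_norm1 H"
    using assms unfolding bounded_clinear_mat_def by blast
  show ?thesis
  proof (rule that[of "\<bar>K\<bar>"])
    fix H :: "'a mat" assume "H \<in> carrier_mat n n"
    then show "mat_norm1 (L H) \<le> \<bar>K\<bar> * mat_norm1 H"
      using K[of H] mult_right_mono[OF abs_ge_self[of K] mat_norm1_nonneg[of H]] by linarith
  qed simp
qed

lemma bounded_clinear_mat_carrier: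
  "bounded_clinear_mat n L \<Longrightarrow> H \<in> carrier_mat n n \<Longrightarrow> L H \<in> carrier_mat n n"
  by (auto simp: bounded_clinear_mat_def)

lemma bounded_clinear_mat_linear:
  assumes "bounded_clinear_mat n L" "H \<in> carrier_mat n n"
  shows "K \<in> carrier_mat n n \<Longrightarrow> L (H + K) = L H + L K"
    and "L (map_mat (scaleC c) H) = c \<cdot>\<^sub>m L H"
  using assms unfolding bounded_clinear_mat_def by blast+

lemma has_mat_derivative_add:
  assumes f: "has_mat_derivative n (fam_app f n) \<beta> L" and g: "has_mat_derivative n (fam_app g n) \<beta> M"
  shows "has_mat_derivative n (fam_app (f + g) n) \<beta> (\<lambda>H. L H + M H)"
proof -
  have bL: "bounded_clinear_mat n L" and bM: "bounded_clinear_mat n M"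
    using f g by (auto simp: has_mat_derivative_def)
  note cL = bounded_clinear_mat_carrier[OF bL] and cM = bounded_clinear_mat_carrier[OF bM]
  obtain K1 where K1: "\<And>H. H \<in> carrier_mat n n \<Longrightarrow> mat_norm1 (L H) \<le> K1 * mat_norm1 H"
    using bounded_clinear_matE[OF bL] by blast
  obtain K2 where K2: "\<And>H. H \<in> carrier_mat n n \<Longrightarrow> mat_norm1 (M H) \<le> K2 * mat_norm1 H"
    using bounded_clinear_matE[OF bM] by blast
  have "bounded_clinear_mat n (\<lambda>H. L H + M H)"
    unfolding bounded_clinear_mat_def
  proof (intro conjI ballI allI exI[of _ "K1 + K2"])
    show "(\<lambda>H. L H + M H) \<in> carrier_mat n n \<rightarrow> carrier_mat n n" using cL cM by auto
  next
    fix H K :: "'a mat" assume HK: "H \<in> carrier_mat n n" "K \<in> carrier_mat n n"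
    then have "L (H + K) = L H + L K" "M (H + K) = M H + M K"
      by (simp_all add: bounded_clinear_mat_linear[OF bL] bounded_clinear_mat_linear[OF bM])
    then show "L (H + K) + M (H + K) = L H + M H + (L K + M K)"
      using cL[OF HK(1)] cL[OF HK(2)] cM[OF HK(1)] cM[OF HK(2)] by (intro eq_matI) auto
  next
    fix c and H :: "'a mat" assume H: "H \<in> carrier_mat n n"
    then have "L (map_mat (scaleC c) H) = c \<cdot>\<^sub>m L H" "M (map_mat (scaleC c) H) = c \<cdot>\<^sub>m M H"
      by (simp_all add: bounded_clinear_mat_linear[OF bL] bounded_clinear_mat_linear[OF bM])
    then show "L (map_mat (scaleC c) H) + M (map_mat (scaleC c) H) = c \<cdot>\<^sub>m (L H + M H)"
      using cL[OF H] cM[OF H] by (simp add: add_smult_distrib_left_mat)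
  next
    fix H :: "'a mat" assume H: "H \<in> carrier_mat n n"
    show "mat_norm1 (L H + M H) \<le> (K1 + K2) * mat_norm1 H"
      using mat_norm1_add_le[OF cL cM, OF H H] K1[OF H] K2[OF H] by (simp add: algebra_simps)
  qed
  moreover have "\<exists>d>0. \<forall>H\<in>carrier_mat n n. mat_norm1 H < d \<longrightarrow>
      mat_norm1 (fam_app (f + g) n (\<beta> + H) - fam_app (f + g) n \<beta> - (L H + M H)) \<le> e * mat_norm1 H"
    if "e > 0" for e
  proof -
    have "e / 2 > 0" using that by simp
    then obtain d1 d2 where d: "d1 > 0" "d2 > 0" and
      d1: "\<And>H. H \<in> carrier_mat n n \<Longrightarrow> mat_norm1 H < d1 \<Longrightarrow>
        mat_norm1 (fam_app f n (\<beta> + H) - fam_app f n \<beta> - L H) \<le> e / 2 * mat_norm1 H" and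
      d2: "\<And>H. H \<in> carrier_mat n n \<Longrightarrow> mat_norm1 H < d2 \<Longrightarrow>
        mat_norm1 (fam_app g n (\<beta> + H) - fam_app g n \<beta> - M H) \<le> e / 2 * mat_norm1 H"
      using f g unfolding has_mat_derivative_def by metis
    show ?thesis
    proof (intro exI[of _ "min d1 d2"] conjI ballI impI)
      fix H :: "'a mat" assume H: "H \<in> carrier_mat n n" and "mat_norm1 H < min d1 d2"
      then have *: "mat_norm1 (fam_app f n (\<beta> + H) - fam_app f n \<beta> - L H) \<le> e / 2 * mat_norm1 H"
        "mat_norm1 (fam_app g n (\<beta> + H) - fam_app g n \<beta> - M H) \<le> e / 2 * mat_norm1 H"
        using d1 d2 by auto
      have "fam_app (f + g) n (\<beta> + H) - fam_app (f + g) n \<beta> - (L H + M H) =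
        (fam_app f n (\<beta> + H) - fam_app f n \<beta> - L H) + (fam_app g n (\<beta> + H) - fam_app g n \<beta> - M H)"
        using cL[OF H] cM[OF H] by (intro eq_matI) (auto simp: fam_app_simps)
      also have "mat_norm1 \<dots> \<le> mat_norm1 (fam_app f n (\<beta> + H) - fam_app f n \<beta> - L H)
          + mat_norm1 (fam_app g n (\<beta> + H) - fam_app g n \<beta> - M H)"
        using cL[OF H] cM[OF H] by (intro mat_norm1_add_le) (auto intro!: minus_carrier_mat)
      finally show "mat_norm1 (fam_app (f + g) n (\<beta> + H) - fam_app (f + g) n \<beta> - (L H + M H))
          \<le> e * mat_norm1 H"
        using * by simp
    qed (use d in simp)
  qed
  ultimately show ?thesis by (simp add: has_mat_derivative_def)
qed

lemma has_mat_derivative_mult: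
  assumes f: "has_mat_derivative n (fam_app f n) \<beta> L" and g: "has_mat_derivative n (fam_app g n) \<beta> M"
  shows "has_mat_derivative n (fam_app (f * g) n) \<beta> (\<lambda>H. L H * fam_app g n \<beta> + fam_app f n \<beta> * M H)"
proof -
  let ?F = "fam_app f n \<beta>" and ?G = "fam_app g n \<beta>"
  have bL: "bounded_clinear_mat n L" and bM: "bounded_clinear_mat n M"
    using f g by (auto simp: has_mat_derivative_def)
  note cL = bounded_clinear_mat_carrier[OF bL] and cM = bounded_clinear_mat_carrier[OF bM]
  obtain K1 where K1: "K1 \<ge> 0" "\<And>H. H \<in> carrier_mat n n \<Longrightarrow> mat_norm1 (L H) \<le> K1 * mat_norm1 H"
    using bounded_clinear_matE[OF bL] by blast
  obtain K2 where K2: "K2 \<ge> 0" "\<And>H. H \<in> carrier_mat n n \<Longrightarrow> mat_norm1 (M H) \<le> K2 * mat_norm1 H"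
    using bounded_clinear_matE[OF bM] by blast
  have "bounded_clinear_mat n (\<lambda>H. L H * ?G + ?F * M H)"
    unfolding bounded_clinear_mat_def
  proof (intro conjI ballI allI exI[of _ "K1 * mat_norm1 ?G + mat_norm1 ?F * K2"])
    show "(\<lambda>H. L H * ?G + ?F * M H) \<in> carrier_mat n n \<rightarrow> carrier_mat n n" using cL cM
      by (simp add: mult_carrier_mat[of _ n n _ n])
  next
    fix H K :: "'a mat" assume HK: "H \<in> carrier_mat n n" "K \<in> carrier_mat n n"
    then have eq: "L (H + K) = L H + L K" "M (H + K) = M H + M K"
      by (simp_all add: bounded_clinear_mat_linear[OF bL] bounded_clinear_mat_linear[OF bM])
    have "L (H + K) * ?G = L H * ?G + L K * ?G" "?F * M (H + K) = ?F * M H + ?F * M K"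
      unfolding eq using add_mult_distrib_mat[OF cL[OF HK(1)] cL[OF HK(2)] fam_app_carrier]
        mult_add_distrib_mat[OF fam_app_carrier cM[OF HK(1)] cM[OF HK(2)]] by auto
    then show "L (H + K) * ?G + ?F * M (H + K) = L H * ?G + ?F * M H + (L K * ?G + ?F * M K)"
      using cL[OF HK(1)] cL[OF HK(2)] cM[OF HK(1)] cM[OF HK(2)]
      by (intro eq_matI) (simp_all del: index_mult_mat(1))
  next
    fix c and H :: "'a mat" assume H: "H \<in> carrier_mat n n"
    then have "L (map_mat (scaleC c) H) = c \<cdot>\<^sub>m L H" "M (map_mat (scaleC c) H) = c \<cdot>\<^sub>m M H"
      by (simp_all add: bounded_clinear_mat_linear[OF bL] bounded_clinear_mat_linear[OF bM])
    then show "L (map_mat (scaleC c) H) * ?G + ?F * M (map_mat (scaleC c) H)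
        = c \<cdot>\<^sub>m (L H * ?G + ?F * M H)"
      using cL[OF H] cM[OF H]
      by (simp add: mult_smult_assoc_mat[of _ n n _ n] mult_smult_distrib[of _ n n _ n]
          add_smult_distrib_left_mat[of _ n n] mult_carrier_mat[of _ n n _ n])
  next
    fix H :: "'a mat" assume H: "H \<in> carrier_mat n n"
    have "mat_norm1 (L H * ?G + ?F * M H) \<le> mat_norm1 (L H) * mat_norm1 ?G + mat_norm1 ?F * mat_norm1 (M H)"
      using mat_norm1_add_le[of "L H * ?G" n "?F * M H"] mat_norm1_mult_le[of "L H" n ?G]
        mat_norm1_mult_le[of ?F n "M H"] cL[OF H] cM[OF H] by (simp add: mult_carrier_mat[of _ n n _ n])
    also have "\<dots> \<le> (K1 * mat_norm1 H) * mat_norm1 ?G + mat_norm1 ?F * (K2 * mat_norm1 H)"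
      by (intro add_mono mult_right_mono mult_left_mono K1 K2 H mat_norm1_nonneg)
    finally show "mat_norm1 (L H * ?G + ?F * M H)
        \<le> (K1 * mat_norm1 ?G + mat_norm1 ?F * K2) * mat_norm1 H" by (simp add: algebra_simps)
  qed
  moreover have "\<exists>d>0. \<forall>H\<in>carrier_mat n n. mat_norm1 H < d \<longrightarrow>
      mat_norm1 (fam_app (f * g) n (\<beta> + H) - fam_app (f * g) n \<beta> - (L H * ?G + ?F * M H)) \<le> e * mat_norm1 H"
    if "e > 0" for e
  proof -
    \<comment> \<open>\<open>C\<close> bounds the remainder of the product relative to \<open>\<eta> \<parallel>H\<parallel>\<close>.\<close>
    define C where "C = mat_norm1 ?G + K2 + 1 + K1 * (K2 + 1) + mat_norm1 ?F"
    have C: "C > 0" unfolding C_def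
      using mat_norm1_nonneg[of ?G] mat_norm1_nonneg[of ?F] K1(1) K2(1)
      by (smt (verit) mult_nonneg_nonneg)
    define \<eta> where "\<eta> = min 1 (e / C)"
    have \<eta>: "\<eta> > 0" "\<eta> \<le> 1" "\<eta> * C \<le> e"
      using C that by (auto simp: \<eta>_def min_def field_simps)
    obtain d1 d2 where d: "d1 > 0" "d2 > 0" and
      d1: "\<And>H. H \<in> carrier_mat n n \<Longrightarrow> mat_norm1 H < d1 \<Longrightarrow>
        mat_norm1 (fam_app f n (\<beta> + H) - ?F - L H) \<le> \<eta> * mat_norm1 H" and
      d2: "\<And>H. H \<in> carrier_mat n n \<Longrightarrow> mat_norm1 H < d2 \<Longrightarrow>
        mat_norm1 (fam_app g n (\<beta> + H) - ?G - M H) \<le> \<eta> * mat_norm1 H"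
      using f g \<eta>(1) unfolding has_mat_derivative_def by metis
    show ?thesis
    proof (intro exI[of _ "min \<eta> (min d1 d2)"] conjI ballI impI)
      fix H :: "'a mat" assume H: "H \<in> carrier_mat n n" and lt: "mat_norm1 H < min \<eta> (min d1 d2)"
      define R where "R = fam_app f n (\<beta> + H) - ?F - L H"
      define S where "S = fam_app g n (\<beta> + H) - ?G - M H"
      define h where "h = mat_norm1 H"
      have h: "0 \<le> h" "h \<le> \<eta>" using lt mat_norm1_nonneg by (auto simp: h_def)
      note c = cL[OF H] cM[OF H]
      have cR: "R \<in> carrier_mat n n" and cS: "S \<in> carrier_mat n n"
        unfolding R_def S_def using c by (auto intro!: minus_carrier_mat)
      have R: "mat_norm1 R \<le> \<eta> * h" and S: "mat_norm1 S \<le> \<eta> * h"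
        using d1[OF H] d2[OF H] lt by (auto simp: R_def S_def h_def)
      have LH: "mat_norm1 (L H) \<le> K1 * h" and MH: "mat_norm1 (M H) \<le> K2 * h"
        using K1 K2 H by (auto simp: h_def)
      have eqf: "fam_app f n (\<beta> + H) = ?F + L H + R" and eqg: "fam_app g n (\<beta> + H) = ?G + (M H + S)"
        unfolding R_def S_def using c by (auto intro!: eq_matI)
      have cMS: "M H + S \<in> carrier_mat n n" using c cS by auto
      have MS: "mat_norm1 (M H + S) \<le> (K2 + 1) * h"
      proof -
        have "\<eta> * h \<le> h" using h(1) \<eta>(2) by (simp add: mult_left_le_one_le \<eta>(1) less_imp_le)
        then show ?thesis using mat_norm1_add_le[OF c(2) cS] MH S by (simp add: algebra_simps)
      qed
      have G': "mat_norm1 (?G + (M H + S)) \<le> mat_norm1 ?G + (K2 + 1)"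
      proof -
        have "(K2 + 1) * h \<le> (K2 + 1) * 1" using h \<eta>(2) K2(1) by (intro mult_left_mono) auto
        then show ?thesis using mat_norm1_add_le[OF fam_app_carrier cMS, of g \<beta>] MS by simp
      qed
      \<comment> \<open>With \<open>f(\<beta> + H) = F + L H + R\<close> and \<open>g(\<beta> + H) = G + M H + S\<close>, only terms that contain a remainder
        or are of second order in \<open>H\<close> are left.\<close>
      have "fam_app (f * g) n (\<beta> + H) - fam_app (f * g) n \<beta> - (L H * ?G + ?F * M H)
        = R * (?G + (M H + S)) + (L H * (M H + S) + ?F * S)"
      proof -
        have "(?F + L H + R) * (?G + (M H + S)) =
            ?F * ?G + (?F * M H + ?F * S) + (L H * ?G + L H * (M H + S)) + R * (?G + (M H + S))"
          using c cR cS cMS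
          by (simp add: add_mult_distrib_mat[of _ n n _ _ n] mult_add_distrib_mat[of _ n n _ n])
            (rule eq_matI, simp_all del: index_mult_mat(1))
        then show ?thesis
          unfolding times_matfam.rep_eq eqf eqg using c cR cS
          by (intro eq_matI) (auto simp del: index_mult_mat(1))
      qed
      then have "mat_norm1 (fam_app (f * g) n (\<beta> + H) - fam_app (f * g) n \<beta> - (L H * ?G + ?F * M H))
        \<le> mat_norm1 R * mat_norm1 (?G + (M H + S)) + (mat_norm1 (L H) * mat_norm1 (M H + S)
            + mat_norm1 ?F * mat_norm1 S)"
        using mat_norm1_add_le[of "R * (?G + (M H + S))" n "L H * (M H + S) + ?F * S"]
          mat_norm1_add_le[of "L H * (M H + S)" n "?F * S"]
          mat_norm1_mult_le[of R n "?G + (M H + S)"] mat_norm1_mult_le[OF c(1) cMS]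
          mat_norm1_mult_le[of ?F n S] c cR cS cMS
        by (auto simp: mult_carrier_mat[of _ n n _ n])
      also have "\<dots> \<le> (\<eta> * h) * (mat_norm1 ?G + (K2 + 1)) + ((K1 * h) * ((K2 + 1) * h)
            + mat_norm1 ?F * (\<eta> * h))"
        using R S LH MS G' h K1(1) K2(1) \<eta>(1)
        by (intro add_mono mult_mono) (auto intro!: mat_norm1_nonneg)
      also have "\<dots> \<le> (\<eta> * h) * (mat_norm1 ?G + (K2 + 1)) + ((K1 * h) * ((K2 + 1) * \<eta>)
            + mat_norm1 ?F * (\<eta> * h))"
        using h K1(1) K2(1) by (intro add_mono mult_left_mono order_refl) auto
      also have "\<dots> = (\<eta> * C) * h" by (simp add: C_def algebra_simps)
      also have "\<dots> \<le> e * h" using \<eta>(3) h(1) by (rule mult_right_mono)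
      finally show "mat_norm1 (fam_app (f * g) n (\<beta> + H) - fam_app (f * g) n \<beta>
          - (L H * ?G + ?F * M H)) \<le> e * mat_norm1 H"
        unfolding h_def .
    qed (use d \<eta> in simp)
  qed
  ultimately show ?thesis by (simp add: has_mat_derivative_def)
qed

lemma has_mat_derivative_zgen:
  assumes "\<phi> \<in> cdual" "0 < n" "\<beta> \<in> carrier_mat n n"
  shows "has_mat_derivative n (fam_app (zgen \<phi>) n) \<beta> (map_mat \<phi>)"
proof -
  interpret \<phi>: bounded_linear \<phi> using assms by (simp add: cdual_def)
  obtain K where K: "\<And>x. norm (\<phi> x) \<le> K * norm x"
    using \<phi>.bounded by (metis mult.commute)
  have "bounded_clinear_mat n (map_mat \<phi>)"
    unfolding bounded_clinear_mat_def
  proof (intro conjI ballI allI exI[of _ K])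
    fix H :: "'a mat"
    show "mat_norm1 (map_mat \<phi> H) \<le> K * mat_norm1 H"
      by (simp add: mat_norm1_def sum_distrib_left sum_mono K)
  qed (use assms(1) in \<open>auto simp: cdual_def \<phi>.add\<close>)
  moreover have "fam_app (zgen \<phi>) n (\<beta> + H) - fam_app (zgen \<phi>) n \<beta> - map_mat \<phi> H = 0\<^sub>m n n"
    if "H \<in> carrier_mat n n" for H
    using that assms(2,3) by (auto simp: zgen.rep_eq \<phi>.add)
  ultimately show ?thesis
    unfolding has_mat_derivative_def
    by (auto intro!: exI[of _ "1::real"] simp: mat_norm1_nonneg)
qed

lemma has_mat_derivative_const:
  assumes "\<And>\<beta>. \<beta> \<in> carrier_mat n n \<Longrightarrow> fam_app f n \<beta> = A" "\<beta> \<in> carrier_mat n n"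
  shows "has_mat_derivative n (fam_app f n) \<beta> (\<lambda>_. 0\<^sub>m n n)"
proof -
  have A: "A \<in> carrier_mat n n" using assms fam_app_carrier by metis
  have "bounded_clinear_mat n (\<lambda>_. 0\<^sub>m n n)"
    by (auto simp: bounded_clinear_mat_def intro!: exI[of _ "0::real"])
  moreover have "fam_app f n (\<beta> + H) - fam_app f n \<beta> - 0\<^sub>m n n = 0\<^sub>m n n" if "H \<in> carrier_mat n n" for H
    using A assms that by simp
  ultimately show ?thesis
    unfolding has_mat_derivative_def
    by (auto intro!: exI[of _ "1::real"] simp: mat_norm1_nonneg)
qed

lemma dirsum_mat_carrier:
  "A \<in> carrier_mat m m \<Longrightarrow> B \<in> carrier_mat n n \<Longrightarrow> dirsum_mat A B \<in> carrier_mat (m + n) (m + n)"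
  by (auto simp: dirsum_mat_def)

lemma dirsum_mat_add:
  fixes A :: "complex mat"
  assumes "A \<in> carrier_mat m m" "B \<in> carrier_mat n n" "A' \<in> carrier_mat m m" "B' \<in> carrier_mat n n"
  shows "dirsum_mat A B + dirsum_mat A' B' = dirsum_mat (A + A') (B + B')"
  using assms by (auto simp: dirsum_mat_def intro!: eq_matI)

lemma dirsum_mat_mult:
  fixes A :: "complex mat"
  assumes "A \<in> carrier_mat m m" "B \<in> carrier_mat n n" "A' \<in> carrier_mat m m" "B' \<in> carrier_mat n n"
  shows "dirsum_mat A B * dirsum_mat A' B' = dirsum_mat (A * A') (B * B')"
  using assms unfolding dirsum_mat_def
  by (simp add: mult_four_block_mat[of _ m m _ n _ n _ _ m _ n])

lemma A_MB_D:
  assumes "f \<in> A_MB" "0 < n" "\<beta> \<in> carrier_mat n n"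
  shows "analytic_mat n (fam_app f n)"
    and "0 < m \<Longrightarrow> \<beta>' \<in> carrier_mat m m \<Longrightarrow>
      fam_app f (n + m) (dirsum_mat \<beta> \<beta>') = dirsum_mat (fam_app f n \<beta>) (fam_app f m \<beta>')"
    and "s \<in> carrier_mat n n \<Longrightarrow> s' \<in> carrier_mat n n \<Longrightarrow> inverts_mat s s' \<and> inverts_mat s' s \<Longrightarrow>
      fam_app f n (tensor_one s * \<beta> * tensor_one s') = s * fam_app f n \<beta> * s'"
  using assms by (simp_all add: A_MB_def)

lemma A_MB_add:
  assumes f: "f \<in> A_MB" and g: "g \<in> A_MB"
  shows "f + g \<in> A_MB"
  unfolding A_MB_def mem_Collect_eq
proof (intro conjI allI impI ballI)
  fix n :: nat assume "n > 0"
  then have "analytic_mat n (fam_app f n)" "analytic_mat n (fam_app g n)"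
    using f g A_MB_D(1)[of _ n "0\<^sub>m n n"] by auto
  then show "analytic_mat n (fam_app (f + g) n)"
    unfolding analytic_mat_iff by (meson has_mat_derivative_add)
next
  fix m n :: nat and \<beta> \<beta>' :: "'a mat"
  assume *: "0 < m" "0 < n" "\<beta> \<in> carrier_mat m m" "\<beta>' \<in> carrier_mat n n"
  then have "fam_app f (m + n) (dirsum_mat \<beta> \<beta>') = dirsum_mat (fam_app f m \<beta>) (fam_app f n \<beta>')"
    "fam_app g (m + n) (dirsum_mat \<beta> \<beta>') = dirsum_mat (fam_app g m \<beta>) (fam_app g n \<beta>')"
    using f g by (simp_all add: A_MB_D(2))
  then show "fam_app (f + g) (m + n) (dirsum_mat \<beta> \<beta>')
      = dirsum_mat (fam_app (f + g) m \<beta>) (fam_app (f + g) n \<beta>')"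
    by (simp add: fam_app_simps
        dirsum_mat_add[OF fam_app_carrier fam_app_carrier fam_app_carrier fam_app_carrier])
next
  fix n :: nat and \<beta> :: "'a mat" and s s' :: "complex mat"
  assume *: "0 < n" "\<beta> \<in> carrier_mat n n" "s \<in> carrier_mat n n" "s' \<in> carrier_mat n n"
    "inverts_mat s s' \<and> inverts_mat s' s"
  then have "fam_app f n (tensor_one s * \<beta> * tensor_one s') = s * fam_app f n \<beta> * s'"
    "fam_app g n (tensor_one s * \<beta> * tensor_one s') = s * fam_app g n \<beta> * s'"
    using f g by (simp_all add: A_MB_D(3))
  then show "fam_app (f + g) n (tensor_one s * \<beta> * tensor_one s') = s * fam_app (f + g) n \<beta> * s'"
    using *(3,4) by (simp add: fam_app_simps mult_add_distrib_mat[of _ n n _ n]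
        add_mult_distrib_mat[of _ n n _ _ n])
qed

lemma A_MB_mult:
  assumes f: "f \<in> A_MB" and g: "g \<in> A_MB"
  shows "f * g \<in> A_MB"
  unfolding A_MB_def mem_Collect_eq
proof (intro conjI allI impI ballI)
  fix n :: nat assume "n > 0"
  then have "analytic_mat n (fam_app f n)" "analytic_mat n (fam_app g n)"
    using f g A_MB_D(1)[of _ n "0\<^sub>m n n"] by auto
  then show "analytic_mat n (fam_app (f * g) n)"
    unfolding analytic_mat_iff by (meson has_mat_derivative_mult)
next
  fix m n :: nat and \<beta> \<beta>' :: "'a mat"
  assume *: "0 < m" "0 < n" "\<beta> \<in> carrier_mat m m" "\<beta>' \<in> carrier_mat n n"
  then have "fam_app f (m + n) (dirsum_mat \<beta> \<beta>') = dirsum_mat (fam_app f m \<beta>) (fam_app f n \<beta>')"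
    "fam_app g (m + n) (dirsum_mat \<beta> \<beta>') = dirsum_mat (fam_app g m \<beta>) (fam_app g n \<beta>')"
    using f g by (simp_all add: A_MB_D(2))
  then show "fam_app (f * g) (m + n) (dirsum_mat \<beta> \<beta>')
      = dirsum_mat (fam_app (f * g) m \<beta>) (fam_app (f * g) n \<beta>')"
    by (simp add: fam_app_simps
        dirsum_mat_mult[OF fam_app_carrier fam_app_carrier fam_app_carrier fam_app_carrier])
next
  fix n :: nat and \<beta> :: "'a mat" and s s' :: "complex mat"
  assume *: "0 < n" "\<beta> \<in> carrier_mat n n" "s \<in> carrier_mat n n" "s' \<in> carrier_mat n n"
    "inverts_mat s s' \<and> inverts_mat s' s"
  let ?F = "fam_app f n \<beta>" and ?G = "fam_app g n \<beta>"
  have eq: "fam_app f n (tensor_one s * \<beta> * tensor_one s') = s * ?F * s'"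
    "fam_app g n (tensor_one s * \<beta> * tensor_one s') = s * ?G * s'"
    using f g * by (simp_all add: A_MB_D(3))
  have "s' * s = 1\<^sub>m n" using * by (auto simp: inverts_mat_def)
  have "s * ?F * s' * (s * ?G * s') = s * ?F * (s' * (s * (?G * s')))"
    using *(3,4) by (simp add: assoc_mult_mat[of _ n n _ n _ n] mult_carrier_mat[of _ n n _ n])
  also have "s' * (s * (?G * s')) = (s' * s) * (?G * s')"
    using *(3,4) by (simp add: assoc_mult_mat[of s' n n s n _ n] mult_carrier_mat[of _ n n _ n])
  also have "\<dots> = ?G * s'"
    using *(4) \<open>s' * s = 1\<^sub>m n\<close> by simp
  also have "s * ?F * (?G * s') = s * (?F * ?G) * s'"
    using *(3,4) by (simp add: assoc_mult_mat[of _ n n _ n _ n] mult_carrier_mat[of _ n n _ n])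
  finally have "s * ?F * s' * (s * ?G * s') = s * (?F * ?G) * s'" .
  then show "fam_app (f * g) n (tensor_one s * \<beta> * tensor_one s') = s * fam_app (f * g) n \<beta> * s'"
    by (simp add: times_matfam.rep_eq eq)
qed

lemma A_MB_scaled_one: "c *\<^sub>C 1 \<in> A_MB"
  unfolding A_MB_def mem_Collect_eq
proof (intro conjI allI impI ballI)
  fix n :: nat assume "n > 0"
  then show "analytic_mat n (fam_app (c *\<^sub>C 1 :: 'a matfam) n)"
    unfolding analytic_mat_iff
    by (intro ballI exI[of _ "\<lambda>_. 0\<^sub>m n n"] has_mat_derivative_const[where A = "c \<cdot>\<^sub>m 1\<^sub>m n"])
      (simp_all add: fam_app_simps)
next
  fix m n :: nat and \<beta> \<beta>' :: "'a mat"
  assume "0 < m" "0 < n" "\<beta> \<in> carrier_mat m m" "\<beta>' \<in> carrier_mat n n"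
  then show "fam_app (c *\<^sub>C 1) (m + n) (dirsum_mat \<beta> \<beta>')
      = dirsum_mat (fam_app (c *\<^sub>C 1) m \<beta>) (fam_app (c *\<^sub>C 1) n \<beta>')"
    by (auto simp: fam_app_simps dirsum_mat_carrier) (auto simp: dirsum_mat_def intro!: eq_matI)
next
  fix n :: nat and \<beta> :: "'a mat" and s s' :: "complex mat"
  assume *: "0 < n" "\<beta> \<in> carrier_mat n n" "s \<in> carrier_mat n n" "s' \<in> carrier_mat n n"
    "inverts_mat s s' \<and> inverts_mat s' s"
  have "tensor_one s * \<beta> * tensor_one s' \<in> carrier_mat n n"
    using * by (auto simp: tensor_one_def)
  moreover have "s * (c \<cdot>\<^sub>m 1\<^sub>m n) * s' = c \<cdot>\<^sub>m (s * s')"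
    using *(3,4) by (simp add: mult_smult_distrib[of _ n n _ n] mult_smult_assoc_mat[of _ n n _ n])
  moreover have "s * s' = 1\<^sub>m n"
    using * by (auto simp: inverts_mat_def)
  ultimately show "fam_app (c *\<^sub>C 1) n (tensor_one s * \<beta> * tensor_one s') = s * fam_app (c *\<^sub>C 1) n \<beta> * s'"
    using * by (simp add: fam_app_simps)
qed

lemma cdual_add: "\<phi> \<in> cdual \<Longrightarrow> \<phi> (x + y) = \<phi> x + \<phi> y"
  by (simp add: cdual_def linear_simps)

lemma cdual_scale: "\<phi> \<in> cdual \<Longrightarrow> \<phi> (c *\<^sub>C x) = c * \<phi> x"
  by (simp add: cdual_def)

lemma cdual_zero [simp]: "\<phi> \<in> cdual \<Longrightarrow> \<phi> 0 = 0"
  by (simp add: cdual_def linear_simps)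

lemma cdual_sum: "\<phi> \<in> cdual \<Longrightarrow> \<phi> (sum f I) = (\<Sum>i\<in>I. \<phi> (f i))"
  by (simp add: cdual_def bounded_linear.linear linear_sum)

lemma A_MB_zgen:
  assumes \<phi>: "\<phi> \<in> cdual"
  shows "zgen \<phi> \<in> A_MB"
  unfolding A_MB_def mem_Collect_eq
proof (intro conjI allI impI ballI)
  fix n :: nat assume "n > 0"
  then show "analytic_mat n (fam_app (zgen \<phi>) n)"
    unfolding analytic_mat_iff using has_mat_derivative_zgen[OF \<phi>] by blast
next
  fix m n :: nat and \<beta> \<beta>' :: "'a mat"
  assume "0 < m" "0 < n" "\<beta> \<in> carrier_mat m m" "\<beta>' \<in> carrier_mat n n"
  then show "fam_app (zgen \<phi>) (m + n) (dirsum_mat \<beta> \<beta>')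
      = dirsum_mat (fam_app (zgen \<phi>) m \<beta>) (fam_app (zgen \<phi>) n \<beta>')"
    using \<phi> by (auto simp: zgen.rep_eq dirsum_mat_carrier) (auto simp: dirsum_mat_def intro!: eq_matI)
next
  fix n :: nat and \<beta> :: "'a mat" and s s' :: "complex mat"
  assume *: "0 < n" "\<beta> \<in> carrier_mat n n" "s \<in> carrier_mat n n" "s' \<in> carrier_mat n n"
    "inverts_mat s s' \<and> inverts_mat s' s"
  have "tensor_one s * \<beta> * tensor_one s' \<in> carrier_mat n n"
    using * by (auto simp: tensor_one_def)
  moreover have "map_mat \<phi> (tensor_one s * \<beta> * tensor_one s') = s * map_mat \<phi> \<beta> * s'"
  proof (rule eq_matI)
    fix i j assume ij: "i < dim_row (s * map_mat \<phi> \<beta> * s')" "j < dim_col (s * map_mat \<phi> \<beta> * s')"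
    then have "(tensor_one s * \<beta> * tensor_one s') $$ (i, j)
        = (\<Sum>l<n. (\<Sum>k<n. s $$ (i, k) *\<^sub>C \<beta> $$ (k, l)) * (s' $$ (l, j) *\<^sub>C 1))"
      using * by (simp add: tensor_one_def scalar_prod_def atLeast0LessThan mult_scaleC_left
          del: assoc_mult_mat)
    also have "\<dots> = (\<Sum>l<n. s' $$ (l, j) *\<^sub>C (\<Sum>k<n. s $$ (i, k) *\<^sub>C \<beta> $$ (k, l)))"
      by (simp add: mult_scaleC_right)
    finally show "map_mat \<phi> (tensor_one s * \<beta> * tensor_one s') $$ (i, j) = (s * map_mat \<phi> \<beta> * s') $$ (i, j)"
      using * ij by (simp add: cdual_sum[OF \<phi>] cdual_scale[OF \<phi>] scalar_prod_def atLeast0LessThan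
          mult.commute tensor_one_def del: assoc_mult_mat)
  qed (use * in \<open>auto simp: tensor_one_def\<close>)
  ultimately show "fam_app (zgen \<phi>) n (tensor_one s * \<beta> * tensor_one s') = s * fam_app (zgen \<phi>) n \<beta> * s'"
    using * by (simp add: zgen.rep_eq)
qed

lemma csubalgebraD:
  assumes "csubalgebra S"
  shows "complex_vector.subspace S" "1 \<in> S" "0 \<in> S" "x \<in> S \<Longrightarrow> y \<in> S \<Longrightarrow> x * y \<in> S"
    "x \<in> S \<Longrightarrow> y \<in> S \<Longrightarrow> x + y \<in> S" "x \<in> S \<Longrightarrow> y \<in> S \<Longrightarrow> x - y \<in> S" "x \<in> S \<Longrightarrow> c *\<^sub>C x \<in> S"
  using assms complex_vector.subspace_0 complex_vector.subspace_add complex_vector.subspace_diff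
    complex_vector.subspace_scale by (auto simp: csubalgebra_def)

lemma scaleC_eq_mult: "c *\<^sub>C x = (c *\<^sub>C 1) * (x :: 'a::complex_algebra_1)"
  by (simp add: mult_scaleC_left)

lemma csubalgebraI:
  fixes S :: "'a::complex_algebra_1 set"
  assumes "\<And>x y. x \<in> S \<Longrightarrow> y \<in> S \<Longrightarrow> x + y \<in> S" "\<And>x y. x \<in> S \<Longrightarrow> y \<in> S \<Longrightarrow> x * y \<in> S"
    "\<And>c. c *\<^sub>C 1 \<in> S"
  shows "csubalgebra S"
proof -
  have "c *\<^sub>C x \<in> S" if "x \<in> S" for c x
    using assms(2)[OF assms(3) that, of c] by (simp flip: scaleC_eq_mult)
  moreover have "0 \<in> S" "1 \<in> S"
    using assms(3)[of 0] assms(3)[of 1] by simp_all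
  ultimately show ?thesis
    using assms by (simp add: csubalgebra_def complex_vector.subspace_def)
qed

lemma csubalgebra_A_MB: "csubalgebra A_MB"
  by (intro csubalgebraI A_MB_add A_MB_mult A_MB_scaled_one)

lemma csubalgebra_Int: "csubalgebra S \<Longrightarrow> csubalgebra T \<Longrightarrow> csubalgebra (S \<inter> T)"
  by (auto simp: csubalgebra_def complex_vector.subspace_inter)

lemma csubalgebra_Inter: "(\<And>S. S \<in> \<C> \<Longrightarrow> csubalgebra S) \<Longrightarrow> csubalgebra (\<Inter>\<C>)"
  by (auto simp: csubalgebra_def complex_vector.subspace_def)

text \<open>
  Inside \<open>A_MB\<close> the hull has the usual properties of a generated subalgebra.  The hypothesis on \<open>G\<close>
  matters: without it no subalgebra of \<open>A_MB\<close> contains \<open>G\<close>, and the hull would be \<open>UNIV\<close>.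
\<close>

lemma csubalgebra_hull_A_MB:
  assumes "G \<subseteq> A_MB"
  defines "H \<equiv> (\<lambda>S. csubalgebra S \<and> S \<subseteq> A_MB) hull G"
  shows "csubalgebra H" "G \<subseteq> H" "csubalgebra S \<Longrightarrow> G \<subseteq> S \<Longrightarrow> H \<subseteq> S"
proof -
  show "csubalgebra H"
    unfolding H_def hull_def by (rule csubalgebra_Inter) auto
  show "G \<subseteq> H" unfolding H_def by (rule hull_subset)
  show "H \<subseteq> S" if "csubalgebra S" "G \<subseteq> S"
  proof -
    have "H \<subseteq> S \<inter> A_MB"
      unfolding H_def using assms(1) that csubalgebra_Int[OF that(1) csubalgebra_A_MB]
      by (intro hull_minimal) auto
    then show ?thesis by simp
  qed
qed

lemma zgen_cdual_subset_A_MB: "zgen ` cdual \<subseteq> A_MB" "zgen ` {\<phi> \<in> cdual. \<phi> 1 = 0} \<subseteq> A_MB"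
  using A_MB_zgen by auto

lemma csubalgebra_Z_dual: "csubalgebra Z_dual"
  unfolding Z_dual_def by (rule csubalgebra_hull_A_MB(1)[OF zgen_cdual_subset_A_MB(1)])

lemma zgen_in_Z_dual: "\<phi> \<in> cdual \<Longrightarrow> zgen \<phi> \<in> Z_dual"
  unfolding Z_dual_def using csubalgebra_hull_A_MB(2)[OF zgen_cdual_subset_A_MB(1)] by auto

lemma Z_dual_subset:
  assumes "csubalgebra S" "\<And>\<phi>. \<phi> \<in> cdual \<Longrightarrow> zgen \<phi> \<in> S"
  shows "Z_dual \<subseteq> S"
  unfolding Z_dual_def
  by (rule csubalgebra_hull_A_MB(3)[OF zgen_cdual_subset_A_MB(1)]) (use assms in auto)

lemma csubalgebra_Z_one_perp: "csubalgebra Z_one_perp"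
  unfolding Z_one_perp_def by (rule csubalgebra_hull_A_MB(1)[OF zgen_cdual_subset_A_MB(2)])

lemma zgen_in_Z_one_perp: "\<phi> \<in> cdual \<Longrightarrow> \<phi> 1 = 0 \<Longrightarrow> zgen \<phi> \<in> Z_one_perp"
  unfolding Z_one_perp_def using csubalgebra_hull_A_MB(2)[OF zgen_cdual_subset_A_MB(2)] by auto

lemma Z_one_perp_subset:
  assumes "csubalgebra S" "\<And>\<phi>. \<phi> \<in> cdual \<Longrightarrow> \<phi> 1 = 0 \<Longrightarrow> zgen \<phi> \<in> S"
  shows "Z_one_perp \<subseteq> S"
  unfolding Z_one_perp_def
  by (rule csubalgebra_hull_A_MB(3)[OF zgen_cdual_subset_A_MB(2)]) (use assms in auto)

lemma Z_one_perp_subset_Z_dual: "Z_one_perp \<subseteq> Z_dual"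
  by (intro Z_one_perp_subset csubalgebra_Z_dual zgen_in_Z_dual)

section \<open>Values on upper triangular block matrices\<close>

text \<open>The block matrix with rows \<open>(\<beta>, X \<otimes> 1)\<close> and \<open>(0, \<beta>')\<close>.\<close>

definition upper_block :: "'b::complex_banach_algebra_1 mat \<Rightarrow> complex mat \<Rightarrow> 'b mat \<Rightarrow> 'b mat" where
  "upper_block \<beta> X \<beta>' = four_block_mat \<beta> (tensor_one X) (0\<^sub>m (dim_row \<beta>') (dim_col \<beta>)) \<beta>'"

text \<open>
  \<open>fdiff f n \<beta> \<beta>' X\<close> is the upper right block of \<open>f\<close> at this matrix, for \<open>\<beta>\<close> and \<open>\<beta>'\<close> of size \<open>n\<close>.  It
  represents the difference quotient \<open>\<partial>f\<close> without a derivative, because the block is homogeneous in \<open>X\<close>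
  for the families of interest.
\<close>

definition fdiff ::
    "'b::complex_banach_algebra_1 matfam \<Rightarrow> nat \<Rightarrow> 'b mat \<Rightarrow> 'b mat \<Rightarrow> complex mat \<Rightarrow> complex mat" where
  "fdiff f n \<beta> \<beta>' X = mat n n (\<lambda>(i, j). fam_app f (n + n) (upper_block \<beta> X \<beta>') $$ (i, n + j))"

text \<open>
  The families that respect upper triangular block matrices and whose upper right block is
  homogeneous in \<open>X\<close>.  They form a subalgebra containing the generators, hence all of \<open>Z_dual\<close>.
\<close>

definition block_triangular :: "'b::complex_banach_algebra_1 matfam set" where
  "block_triangular = {f. \<forall>n>0. \<forall>\<beta>\<in>carrier_mat n n. \<forall>\<beta>'\<in>carrier_mat n n. \<forall>X\<in>carrier_mat n n.
     fam_app f (n + n) (upper_block \<beta> X \<beta>')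
       = four_block_mat (fam_app f n \<beta>) (fdiff f n \<beta> \<beta>' X) (0\<^sub>m n n) (fam_app f n \<beta>') \<and>
     (\<forall>c. fdiff f n \<beta> \<beta>' (c \<cdot>\<^sub>m X) = c \<cdot>\<^sub>m fdiff f n \<beta> \<beta>' X)}"

lemma fdiff_carrier [simp]: "fdiff f n \<beta> \<beta>' X \<in> carrier_mat n n"
  by (simp add: fdiff_def)

lemma fdiff_dim [simp]: "dim_row (fdiff f n \<beta> \<beta>' X) = n" "dim_col (fdiff f n \<beta> \<beta>' X) = n"
  by (simp_all add: fdiff_def)

lemma fdiff_add: "fdiff (f + g) n \<beta> \<beta>' X = fdiff f n \<beta> \<beta>' X + fdiff g n \<beta> \<beta>' X"
  by (intro eq_matI) (auto simp: fdiff_def fam_app_simps)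

lemma fdiff_scaleC: "fdiff (c *\<^sub>C f) n \<beta> \<beta>' X = c \<cdot>\<^sub>m fdiff f n \<beta> \<beta>' X"
  by (intro eq_matI) (auto simp: fdiff_def fam_app_simps)

lemma block_triangularD:
  assumes "f \<in> block_triangular" "0 < n" "\<beta> \<in> carrier_mat n n" "\<beta>' \<in> carrier_mat n n" "X \<in> carrier_mat n n"
  shows "fam_app f (n + n) (upper_block \<beta> X \<beta>')
      = four_block_mat (fam_app f n \<beta>) (fdiff f n \<beta> \<beta>' X) (0\<^sub>m n n) (fam_app f n \<beta>')"
    and "fdiff f n \<beta> \<beta>' (c \<cdot>\<^sub>m X) = c \<cdot>\<^sub>m fdiff f n \<beta> \<beta>' X"
  using assms by (simp_all add: block_triangular_def)

lemma fdiff_eqI: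
  assumes "fam_app f (n + n) (upper_block \<beta> X \<beta>') = four_block_mat A B C D"
    "A \<in> carrier_mat n n" "B \<in> carrier_mat n n" "C \<in> carrier_mat n n" "D \<in> carrier_mat n n"
  shows "fdiff f n \<beta> \<beta>' X = B"
  using assms by (intro eq_matI) (auto simp: fdiff_def)

text \<open>Exhibiting the upper right block \<open>T\<close> proves membership and computes \<open>fdiff\<close> at once.\<close>

lemma block_triangularI:
  assumes "\<And>n \<beta> \<beta>' X. 0 < n \<Longrightarrow> \<beta> \<in> carrier_mat n n \<Longrightarrow> \<beta>' \<in> carrier_mat n n \<Longrightarrow> X \<in> carrier_mat n n \<Longrightarrow>
      T n \<beta> \<beta>' X \<in> carrier_mat n n \<and>
      fam_app f (n + n) (upper_block \<beta> X \<beta>')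
        = four_block_mat (fam_app f n \<beta>) (T n \<beta> \<beta>' X) (0\<^sub>m n n) (fam_app f n \<beta>')"
    and "\<And>n \<beta> \<beta>' X c. 0 < n \<Longrightarrow> \<beta> \<in> carrier_mat n n \<Longrightarrow> \<beta>' \<in> carrier_mat n n \<Longrightarrow> X \<in> carrier_mat n n \<Longrightarrow>
      T n \<beta> \<beta>' (c \<cdot>\<^sub>m X) = c \<cdot>\<^sub>m T n \<beta> \<beta>' X"
  shows "f \<in> block_triangular"
    and "0 < n \<Longrightarrow> \<beta> \<in> carrier_mat n n \<Longrightarrow> \<beta>' \<in> carrier_mat n n \<Longrightarrow> X \<in> carrier_mat n n \<Longrightarrow>
      fdiff f n \<beta> \<beta>' X = T n \<beta> \<beta>' X"
proof -
  show *: "fdiff f n \<beta> \<beta>' X = T n \<beta> \<beta>' X"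
    if "0 < n" "\<beta> \<in> carrier_mat n n" "\<beta>' \<in> carrier_mat n n" "X \<in> carrier_mat n n" for n \<beta> \<beta>' X
    using assms(1)[OF that] by (auto intro: fdiff_eqI)
  show "f \<in> block_triangular"
    unfolding block_triangular_def using assms by (simp add: *)
qed

lemma upper_block_carrier:
  "\<beta> \<in> carrier_mat n n \<Longrightarrow> X \<in> carrier_mat n n \<Longrightarrow> \<beta>' \<in> carrier_mat n n \<Longrightarrow>
    upper_block \<beta> X \<beta>' \<in> carrier_mat (n + n) (n + n)"
  by (auto simp: upper_block_def)

lemma block_triangular_add:
  assumes f: "f \<in> block_triangular" and g: "g \<in> block_triangular"
  shows "f + g \<in> block_triangular"
proof (rule block_triangularI(1)[where T = "\<lambda>n \<beta> \<beta>' X. fdiff f n \<beta> \<beta>' X + fdiff g n \<beta> \<beta>' X"], goal_cases)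
  case (1 n \<beta> \<beta>' X)
  then show ?case
    by (simp add: fam_app_simps block_triangularD(1)[OF f 1] block_triangularD(1)[OF g 1]
        add_four_block_mat[of _ n n _ n _ n])
next
  case (2 n \<beta> \<beta>' X c)
  then show ?case
    using block_triangularD(2)[OF f 2] block_triangularD(2)[OF g 2]
by (simp add: add_smult_distrib_left_mat[of _ n n])
qed

text \<open>The Leibniz rule is multiplication of upper triangular block matrices.\<close>

lemma
  assumes f: "f \<in> block_triangular" and g: "g \<in> block_triangular"
  shows block_triangular_mult: "f * g \<in> block_triangular"
    and fdiff_mult: "0 < n \<Longrightarrow> \<beta> \<in> carrier_mat n n \<Longrightarrow> \<beta>' \<in> carrier_mat n n \<Longrightarrow> X \<in> carrier_mat n n \<Longrightarrow>
      fdiff (f * g) n \<beta> \<beta>' X = fam_app f n \<beta> * fdiff g n \<beta> \<beta>' X + fdiff f n \<beta> \<beta>' X * fam_app g n \<beta>'"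
proof -
  let ?T = "\<lambda>n \<beta> \<beta>' X. fam_app f n \<beta> * fdiff g n \<beta> \<beta>' X + fdiff f n \<beta> \<beta>' X * fam_app g n \<beta>'"
  have 1: "?T n \<beta> \<beta>' X \<in> carrier_mat n n \<and> fam_app (f * g) (n + n) (upper_block \<beta> X \<beta>')
        = four_block_mat (fam_app (f * g) n \<beta>) (?T n \<beta> \<beta>' X) (0\<^sub>m n n) (fam_app (f * g) n \<beta>')"
    if *: "0 < n" "\<beta> \<in> carrier_mat n n" "\<beta>' \<in> carrier_mat n n" "X \<in> carrier_mat n n" for n \<beta> \<beta>' X
    by (simp add: times_matfam.rep_eq block_triangularD(1)[OF f *] block_triangularD(1)[OF g *]
        mult_four_block_mat[of _ n n _ n _ n _ _ n _ n] mult_carrier_mat[of _ n n _ n])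
  have 2: "?T n \<beta> \<beta>' (c \<cdot>\<^sub>m X) = c \<cdot>\<^sub>m ?T n \<beta> \<beta>' X"
    if *: "0 < n" "\<beta> \<in> carrier_mat n n" "\<beta>' \<in> carrier_mat n n" "X \<in> carrier_mat n n" for n \<beta> \<beta>' X c
    by (simp add: block_triangularD(2)[OF f *] block_triangularD(2)[OF g *]
        mult_smult_assoc_mat[of _ n n _ n] mult_smult_distrib[of _ n n _ n]
        add_smult_distrib_left_mat[of _ n n] mult_carrier_mat[of _ n n _ n])
  show "f * g \<in> block_triangular"
    using 1 2 by (rule block_triangularI(1))
  show "fdiff (f * g) n \<beta> \<beta>' X = ?T n \<beta> \<beta>' X"
    if "0 < n" "\<beta> \<in> carrier_mat n n" "\<beta>' \<in> carrier_mat n n" "X \<in> carrier_mat n n"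
    using 1 2 that by (rule block_triangularI(2))
qed

lemma block_triangular_scaled_one: "c *\<^sub>C 1 \<in> (block_triangular :: 'a::complex_banach_algebra_1 matfam set)"
  and fdiff_scaled_one: "0 < n \<Longrightarrow> \<beta> \<in> carrier_mat n n \<Longrightarrow> \<beta>' \<in> carrier_mat n n \<Longrightarrow> X \<in> carrier_mat n n \<Longrightarrow>
      fdiff (c *\<^sub>C 1 :: 'a matfam) n \<beta> \<beta>' X = 0\<^sub>m n n"
proof -
  have 1: "0\<^sub>m n n \<in> carrier_mat n n \<and> fam_app (c *\<^sub>C 1) (n + n) (upper_block \<beta> X \<beta>')
        = four_block_mat (fam_app (c *\<^sub>C 1) n \<beta>) (0\<^sub>m n n) (0\<^sub>m n n) (fam_app (c *\<^sub>C 1) n \<beta>')"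
    if *: "0 < n" "\<beta> \<in> carrier_mat n n" "\<beta>' \<in> carrier_mat n n" "X \<in> carrier_mat n n"
    for n X and \<beta> \<beta>' :: "'a mat"
    using * upper_block_carrier[OF *(2,4,3)] by (intro conjI eq_matI) (auto simp: fam_app_simps)
  have 2: "0\<^sub>m n n = d \<cdot>\<^sub>m 0\<^sub>m n n" for n and d :: complex by auto
  show "c *\<^sub>C 1 \<in> (block_triangular :: 'a matfam set)"
    by (rule block_triangularI(1)[where T = "\<lambda>n _ _ _. 0\<^sub>m n n"]) (use 1 2 in auto)
  show "fdiff (c *\<^sub>C 1 :: 'a matfam) n \<beta> \<beta>' X = 0\<^sub>m n n"
    if "0 < n" "\<beta> \<in> carrier_mat n n" "\<beta>' \<in> carrier_mat n n" "X \<in> carrier_mat n n"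
    by (rule block_triangularI(2)[where T = "\<lambda>n _ _ _. 0\<^sub>m n n"]) (use 1 2 that in auto)
qed

lemma
  assumes \<phi>: "\<phi> \<in> cdual"
  shows block_triangular_zgen: "zgen \<phi> \<in> block_triangular"
    and fdiff_zgen: "0 < n \<Longrightarrow> \<beta> \<in> carrier_mat n n \<Longrightarrow> \<beta>' \<in> carrier_mat n n \<Longrightarrow> X \<in> carrier_mat n n \<Longrightarrow>
      fdiff (zgen \<phi>) n \<beta> \<beta>' X = \<phi> 1 \<cdot>\<^sub>m X"
proof -
  have 1: "\<phi> 1 \<cdot>\<^sub>m X \<in> carrier_mat n n \<and> fam_app (zgen \<phi>) (n + n) (upper_block \<beta> X \<beta>')
        = four_block_mat (fam_app (zgen \<phi>) n \<beta>) (\<phi> 1 \<cdot>\<^sub>m X) (0\<^sub>m n n) (fam_app (zgen \<phi>) n \<beta>')"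
    if *: "0 < n" "\<beta> \<in> carrier_mat n n" "\<beta>' \<in> carrier_mat n n" "X \<in> carrier_mat n n"
    for n X and \<beta> \<beta>' :: "'a mat"
    using * upper_block_carrier[OF *(2,4,3)] \<phi>
    by (auto intro!: eq_matI simp: zgen.rep_eq upper_block_def tensor_one_def cdual_scale)
  have 2: "\<phi> 1 \<cdot>\<^sub>m (d \<cdot>\<^sub>m X) = d \<cdot>\<^sub>m (\<phi> 1 \<cdot>\<^sub>m X)" for d X by auto
  show "zgen \<phi> \<in> block_triangular"
    using 1 2 by (rule block_triangularI(1))
  show "fdiff (zgen \<phi>) n \<beta> \<beta>' X = \<phi> 1 \<cdot>\<^sub>m X"
    if "0 < n" "\<beta> \<in> carrier_mat n n" "\<beta>' \<in> carrier_mat n n" "X \<in> carrier_mat n n"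
    using 1 2 that by (rule block_triangularI(2))
qed

lemma csubalgebra_block_triangular: "csubalgebra block_triangular"
  by (intro csubalgebraI block_triangular_add block_triangular_mult block_triangular_scaled_one)

lemma Z_dual_block_triangular: "Z_dual \<subseteq> block_triangular"
  by (intro Z_dual_subset csubalgebra_block_triangular block_triangular_zgen)

section \<open>Dilation in the direction of the unit\<close>

text \<open>
  The entrywise map \<open>\<beta> \<mapsto> \<beta> + (\<mu> - 1) \<theta>(\<beta>) \<otimes> 1\<close>.  If \<open>\<theta>(1) = 1\<close>, it multiplies \<open>\<theta>(\<beta>)\<close> by \<open>\<mu>\<close> and leaves
  \<open>\<phi>(\<beta>)\<close> unchanged whenever \<open>\<phi>(1) = 0\<close>.
\<close>

definition shift_mat :: "('b::complex_banach_algebra_1 \<Rightarrow> complex) \<Rightarrow> complex \<Rightarrow> 'b mat \<Rightarrow> 'b mat" where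
  "shift_mat \<theta> \<mu> = map_mat (\<lambda>b. b + ((\<mu> - 1) * \<theta> b) *\<^sub>C 1)"

text \<open>Substitution of the shifted matrix, an algebra endomorphism.\<close>

lift_definition dilate ::
    "('b::complex_banach_algebra_1 \<Rightarrow> complex) \<Rightarrow> complex \<Rightarrow> 'b matfam \<Rightarrow> 'b matfam" is
  "\<lambda>\<theta> \<mu> f n \<beta>. if 0 < n \<and> \<beta> \<in> carrier_mat n n then f n (shift_mat \<theta> \<mu> \<beta>) else 0\<^sub>m n n"
  by auto

lemma shift_mat_carrier [simp]: "shift_mat \<theta> \<mu> \<beta> \<in> carrier_mat n m \<longleftrightarrow> \<beta> \<in> carrier_mat n m"
  by (auto simp: shift_mat_def)

lemma shift_mat_one [simp]: "shift_mat \<theta> 1 \<beta> = \<beta>"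
  by (auto simp: shift_mat_def)

lemma dilate_one [simp]: "dilate \<theta> 1 f = f"
  by (rule matfam_eqI) (simp add: dilate.rep_eq)

lemma dilate_add: "dilate \<theta> \<mu> (f + g) = dilate \<theta> \<mu> f + dilate \<theta> \<mu> g"
  by (rule matfam_eqI) (simp add: dilate.rep_eq fam_app_simps)

lemma dilate_mult: "dilate \<theta> \<mu> (f * g) = dilate \<theta> \<mu> f * dilate \<theta> \<mu> g"
  by (rule matfam_eqI) (simp add: dilate.rep_eq fam_app_simps)

lemma dilate_scaleC: "dilate \<theta> \<mu> (c *\<^sub>C f) = c *\<^sub>C dilate \<theta> \<mu> f"
  by (rule matfam_eqI) (simp add: dilate.rep_eq fam_app_simps)

lemma dilate_1_arg [simp]: "dilate \<theta> \<mu> 1 = 1"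
  by (rule matfam_eqI) (simp add: dilate.rep_eq fam_app_simps)

lemma dilate_zgen:
  assumes "\<phi> \<in> cdual"
  shows "dilate \<theta> \<mu> (zgen \<phi>) = zgen \<phi> + ((\<mu> - 1) * \<phi> 1) *\<^sub>C zgen \<theta>"
  by (rule matfam_eqI, rule eq_matI)
    (simp_all add: dilate.rep_eq fam_app_simps zgen.rep_eq shift_mat_def cdual_add[OF assms] cdual_scale[OF assms])

lemma dilate_Z_one_perp:
  assumes "c \<in> Z_one_perp"
  shows "dilate \<theta> \<mu> c = c"
proof -
  have "Z_one_perp \<subseteq> {f. dilate \<theta> \<mu> f = f}"
    by (intro Z_one_perp_subset csubalgebraI)
      (auto simp: dilate_add dilate_mult dilate_scaleC dilate_zgen)
  then show ?thesis using assms by auto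
qed

section \<open>Twisted cyclic derivatives\<close>

text \<open>The trace of a matrix.\<close>

definition mtrace :: "'a::comm_ring mat \<Rightarrow> 'a" where
  "mtrace A = (\<Sum>i<dim_row A. A $$ (i, i))"

lemma mtrace_mult_comm:
  assumes "A \<in> carrier_mat n n" "B \<in> carrier_mat n n"
  shows "mtrace (A * B) = mtrace (B * A)"
proof -
  have "mtrace (A * B) = (\<Sum>i<n. \<Sum>k<n. A $$ (i, k) * B $$ (k, i))"
    using assms by (simp add: mtrace_def scalar_prod_def atLeast0LessThan)
  also have "\<dots> = (\<Sum>k<n. \<Sum>i<n. B $$ (k, i) * A $$ (i, k))"
    by (subst sum.swap) (simp add: mult.commute)
  also have "\<dots> = mtrace (B * A)"
    using assms by (simp add: mtrace_def scalar_prod_def atLeast0LessThan)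
  finally show ?thesis .
qed

lemma mtrace_add: "A \<in> carrier_mat n n \<Longrightarrow> B \<in> carrier_mat n n \<Longrightarrow> mtrace (A + B) = mtrace A + mtrace B"
  by (simp add: mtrace_def sum.distrib)

lemma mtrace_smult: "A \<in> carrier_mat n n \<Longrightarrow> mtrace (c \<cdot>\<^sub>m A) = c * mtrace A"
  by (simp add: mtrace_def sum_distrib_left)

lemma mat_unit_carrier [simp]: "mat_unit m n i j \<in> carrier_mat m n"
  by (simp add: mat_unit_def)

lemma mtrace_mat_unit_mult:
  fixes A :: "complex mat"
  assumes "A \<in> carrier_mat n n" "i < n" "j < n"
  shows "mtrace (mat_unit n n j i * A) = A $$ (i, j)"
proof -
  have "mtrace (mat_unit n n j i * A)
      = (\<Sum>k<n. \<Sum>l<n. (if k = j \<and> l = i then 1 else 0) * A $$ (l, k))"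
    using assms by (simp add: mtrace_def mat_unit_def scalar_prod_def atLeast0LessThan)
  moreover have "(\<Sum>l<n. (if k = j \<and> l = i then 1 else 0) * A $$ (l, k))
      = (if k = j then \<Sum>l<n. if l = i then A $$ (l, k) else 0 else 0)" for k
    by (cases "k = j") (simp_all add: if_distrib[of "\<lambda>x. x * _"] cong: if_cong)
  ultimately show ?thesis using assms by simp
qed

text \<open>
  The family \<open>L\<^sub>\<mu>(f | h)\<close> whose entry \<open>(i, j)\<close> at \<open>\<beta>\<close> is \<open>tr (\<partial>f(\<beta>\<^sub>\<mu>, \<beta>)(e\<^sub>j\<^sub>i) h(\<beta>))\<close>, where \<open>\<beta>\<^sub>\<mu>\<close> is the shifted
  matrix.  When \<open>\<partial>f\<close> is linear in its direction, this says that
  \<open>tr (L\<^sub>\<mu>(f | h)(\<beta>) X) = tr (\<partial>f(\<beta>\<^sub>\<mu>, \<beta>)(X) h(\<beta>))\<close> for all \<open>X\<close>.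
\<close>

definition twisted_deriv ::
    "('b::complex_banach_algebra_1 \<Rightarrow> complex) \<Rightarrow> complex \<Rightarrow> 'b matfam \<Rightarrow> 'b matfam \<Rightarrow> 'b matfam" where
  "twisted_deriv \<theta> \<mu> f h = Abs_matfam (\<lambda>n \<beta>. if 0 < n \<and> \<beta> \<in> carrier_mat n n
     then mat n n (\<lambda>(i, j). mtrace (fdiff f n (shift_mat \<theta> \<mu> \<beta>) \<beta> (mat_unit n n j i) * fam_app h n \<beta>))
     else 0\<^sub>m n n)"

lemma fam_app_twisted_deriv:
  assumes "0 < n" "\<beta> \<in> carrier_mat n n"
  shows "fam_app (twisted_deriv \<theta> \<mu> f h) n \<beta>
    = mat n n (\<lambda>(i, j). mtrace (fdiff f n (shift_mat \<theta> \<mu> \<beta>) \<beta> (mat_unit n n j i) * fam_app h n \<beta>))"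
  unfolding twisted_deriv_def using assms by (subst Abs_matfam_inverse) auto

lemma twisted_deriv_add: "twisted_deriv \<theta> \<mu> (f + g) h = twisted_deriv \<theta> \<mu> f h + twisted_deriv \<theta> \<mu> g h"
  by (rule matfam_eqI, rule eq_matI)
    (auto simp: fam_app_twisted_deriv fam_app_simps fdiff_add
      mtrace_add[OF mult_carrier_mat[OF fdiff_carrier fam_app_carrier] mult_carrier_mat[OF fdiff_carrier fam_app_carrier]]
      add_mult_distrib_mat[OF fdiff_carrier fdiff_carrier fam_app_carrier])

lemma twisted_deriv_scaleC: "twisted_deriv \<theta> \<mu> (c *\<^sub>C f) h = c *\<^sub>C twisted_deriv \<theta> \<mu> f h"
  by (rule matfam_eqI, rule eq_matI)
    (auto simp: fam_app_twisted_deriv fam_app_simps fdiff_scaleC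
      mtrace_smult[OF mult_carrier_mat[OF fdiff_carrier fam_app_carrier]]
      mult_smult_assoc_mat[OF fdiff_carrier fam_app_carrier])

lemma twisted_deriv_zgen:
  assumes "\<phi> \<in> cdual"
  shows "twisted_deriv \<theta> \<mu> (zgen \<phi>) h = \<phi> 1 *\<^sub>C h"
  by (rule matfam_eqI, rule eq_matI)
    (auto simp: fam_app_twisted_deriv fam_app_simps fdiff_zgen[OF assms] mtrace_mat_unit_mult
      mtrace_smult[OF mult_carrier_mat[OF mat_unit_carrier fam_app_carrier]]
      mult_smult_assoc_mat[OF mat_unit_carrier fam_app_carrier])

lemma twisted_deriv_scaled_one: "twisted_deriv \<theta> \<mu> (c *\<^sub>C 1) h = 0"
  by (rule matfam_eqI, rule eq_matI)
    (auto simp: fam_app_twisted_deriv fam_app_simps fdiff_scaled_one left_mult_zero_mat[OF fam_app_carrier] mtrace_def)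

lemma twisted_deriv_zero_right: "twisted_deriv \<theta> \<mu> f 0 = 0"
  by (rule matfam_eqI, rule eq_matI)
    (auto simp: fam_app_twisted_deriv fam_app_simps right_mult_zero_mat[OF fdiff_carrier] mtrace_def)

text \<open>
  The Leibniz rule in trace form; cyclicity of the trace moves the left factor \<open>f(\<beta>\<^sub>\<mu>)\<close> behind \<open>h\<close>.
\<close>

lemma twisted_deriv_mult:
  assumes f: "f \<in> block_triangular" and g: "g \<in> block_triangular"
  shows "twisted_deriv \<theta> \<mu> (f * g) h
    = twisted_deriv \<theta> \<mu> f (g * h) + twisted_deriv \<theta> \<mu> g (h * dilate \<theta> \<mu> f)"
proof (rule matfam_eqI, rule eq_matI, goal_cases)
  case (1 n \<beta> i j)
  then have ij: "i < n" "j < n" by auto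
  let ?E = "mat_unit n n j i" and ?\<beta> = "shift_mat \<theta> \<mu> \<beta>"
  let ?F = "fam_app f n ?\<beta>" and ?G = "fam_app g n \<beta>" and ?H = "fam_app h n \<beta>"
  let ?S = "fdiff f n ?\<beta> \<beta> ?E" and ?T = "fdiff g n ?\<beta> \<beta> ?E"
  note [simp] = mult_carrier_mat[of _ n n _ n]
  have "mtrace (fdiff (f * g) n ?\<beta> \<beta> ?E * ?H) = mtrace ((?F * ?T + ?S * ?G) * ?H)"
    using 1 by (simp add: fdiff_mult[OF f g])
  also have "(?F * ?T + ?S * ?G) * ?H = ?F * (?T * ?H) + ?S * (?G * ?H)"
    by (simp add: add_mult_distrib_mat[of _ n n _ _ n] assoc_mult_mat[of _ n n _ n _ n])
  also have "mtrace \<dots> = mtrace (?F * (?T * ?H)) + mtrace (?S * (?G * ?H))"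
    by (rule mtrace_add[of _ n]) simp_all
  also have "mtrace (?F * (?T * ?H)) = mtrace (?T * (?H * ?F))"
    by (subst mtrace_mult_comm[of _ n]) (simp_all add: assoc_mult_mat[of _ n n _ n _ n])
  finally show ?case
    using 1 ij by (simp add: fam_app_twisted_deriv fam_app_simps dilate.rep_eq add.commute del: assoc_mult_mat)
qed simp_all

text \<open>
  For \<open>\<mu> = 1\<close> and \<open>h = 1\<close> the twisted derivative is the cyclic derivative: contracting the flipped
  tensor \<open>\<Sum> t a b c d e\<^sub>a\<^sub>b \<otimes> e\<^sub>c\<^sub>d\<close> leaves \<open>\<Sum>b. t b j i b\<close> in position \<open>(i, j)\<close>, which is the trace of the
  upper right block for \<open>X = e\<^sub>j\<^sub>i\<close>.
\<close>

lemma cyc_deriv_eq_twisted_deriv: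
  assumes f: "f \<in> block_triangular"
  shows "cyc_deriv f = twisted_deriv \<theta> 1 f 1"
proof (rule matfam_eqI, rule eq_matI, goal_cases)
  case (1 n \<beta> i j)
  then have ij: "i < n" "j < n" and n: "0 < n" and \<beta>: "\<beta> \<in> carrier_mat n n" by auto
  have unit_mult: "(mat_unit n n a b * mat_unit n n c d) $$ (i, j)
      = (if a = i then if d = j then if b = c then 1 else 0 else 0 else (0::complex))"
    if "a < n" "b < n" "c < n" "d < n" for a b c d
  proof -
    have "(mat_unit n n a b * mat_unit n n c d) $$ (i, j) =
        (\<Sum>k<n. (if i = a \<and> k = b then 1 else 0) * (if k = c \<and> j = d then 1 else (0::complex)))"
      using ij by (simp add: mat_unit_def scalar_prod_def atLeast0LessThan)
    also have "\<dots> = (\<Sum>k<n. if k = b then (if i = a \<and> b = c \<and> j = d then 1 else 0) else 0)"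
      by (rule sum.cong) auto
    also have "\<dots> = (if i = a \<and> b = c \<and> j = d then 1 else 0)"
      using that by simp
    finally show ?thesis by auto
  qed
  have tensor_mult: "tensor_mult n t $$ (i, j) = (\<Sum>b<n. t i b b j)" for t
  proof -
    have "tensor_mult n t $$ (i, j) = (\<Sum>a<n. \<Sum>b<n. \<Sum>c<n. \<Sum>d<n.
        t a b c d * (mat_unit n n a b * mat_unit n n c d) $$ (i, j))"
      using ij by (simp add: tensor_mult_def del: index_mult_mat)
    also have "\<dots> = (\<Sum>a<n. \<Sum>b<n. \<Sum>c<n. \<Sum>d<n.
        if d = j then if a = i then if b = c then t a b c d else 0 else 0 else 0)"
      by (intro sum.cong refl) (simp add: unit_mult)
    also have "\<dots> = (\<Sum>a<n. \<Sum>b<n. \<Sum>c<n. if c = b then if a = i then t a b c j else 0 else 0)"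
      using ij by (auto simp: sum.delta intro!: sum.cong)
    also have "\<dots> = (\<Sum>a<n. \<Sum>b<n. if a = i then t a b b j else 0)"
      by (intro sum.cong refl) simp
    also have "\<dots> = (\<Sum>b<n. \<Sum>a<n. if a = i then t a b b j else 0)"
      by (rule sum.swap)
    also have "\<dots> = (\<Sum>b<n. t i b b j)" using ij by simp
    finally show ?thesis .
  qed
  have fdq: "fdq f n n \<beta> \<beta> b j i b = fdiff f n \<beta> \<beta> (mat_unit n n j i) $$ (b, b)" if b: "b < n" for b
  proof -
    let ?E = "mat_unit n n j i :: complex mat"
    have "four_block_mat \<beta> (map_mat (scaleC \<epsilon>) (mat_unit n n j i)) (0\<^sub>m n n) \<beta> = upper_block \<beta> (\<epsilon> \<cdot>\<^sub>m ?E) \<beta>" for \<epsilon>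
      using \<beta> by (auto simp: upper_block_def tensor_one_def mat_unit_def intro!: cong_four_block_mat eq_matI)
    then have "fam_app f (n + n) (four_block_mat \<beta> (map_mat (scaleC \<epsilon>) (mat_unit n n j i)) (0\<^sub>m n n) \<beta>) $$ (b, n + b)
        = \<epsilon> * fdiff f n \<beta> \<beta> ?E $$ (b, b)" for \<epsilon>
      using b by (simp add: block_triangularD(1)[OF f n \<beta> \<beta>] block_triangularD(2)[OF f n \<beta> \<beta>])
    then show ?thesis
      by (simp add: fdq_def)
  qed
  have "tensor_mult n (tensor_flip (fdq f n n \<beta> \<beta>)) $$ (i, j)
      = (\<Sum>b<n. fdiff f n \<beta> \<beta> (mat_unit n n j i) $$ (b, b))"
    by (simp add: tensor_mult tensor_flip_def fdq)
  then show ?case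
    using n \<beta> ij by (simp add: cyc_deriv.rep_eq fam_app_twisted_deriv fam_app_simps mtrace_def
        right_mult_one_mat[OF fdiff_carrier])
qed simp_all

section \<open>Linear maps on spans\<close>

lemma clinear_onD:
  assumes "clinear_on S T h" "x \<in> S"
  shows "h x \<in> T" "y \<in> S \<Longrightarrow> h (x + y) = h x + h y" "h (c *\<^sub>C x) = c *\<^sub>C h x"
  using assms by (auto simp: clinear_on_def)

lemma clinear_on_UNIV:
  "clinear_on UNIV UNIV h \<longleftrightarrow> (\<forall>x y. h (x + y) = h x + h y) \<and> (\<forall>c x. h (c *\<^sub>C x) = c *\<^sub>C h x)"
  by (auto simp: clinear_on_def)

lemma clinear_UNIV_diff:
  assumes "clinear_on UNIV UNIV h"
  shows "h 0 = 0" "h (x - y) = h x - h y"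
proof -
  show "h 0 = 0" using clinear_onD(3)[OF assms, of 0 0] by simp
  have "h (x - y) + h y = h x" using clinear_onD(2)[OF assms, of "x - y" y] by simp
  then show "h (x - y) = h x - h y" by (simp add: algebra_simps)
qed

lemma clinear_UNIV_sum: "clinear_on UNIV UNIV h \<Longrightarrow> h (sum f I) = (\<Sum>i\<in>I. h (f i))"
  by (induction I rule: infinite_finite_induct) (simp_all add: clinear_UNIV_diff(1) clinear_onD(2))

lemma clinear_span_mapsto:
  assumes h: "clinear_on UNIV UNIV h" and V: "complex_vector.subspace V"
    and S: "\<And>x. x \<in> S \<Longrightarrow> h x \<in> V" and x: "x \<in> complex_vector.span S"
  shows "h x \<in> V"
proof -
  have "complex_vector.subspace {x. h x \<in> V}"
    using V by (auto simp: complex_vector.subspace_def clinear_UNIV_diff(1)[OF h] clinear_onD[OF h])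
  then have "complex_vector.span S \<subseteq> {x. h x \<in> V}"
    using S by (intro complex_vector.span_minimal) auto
  then show ?thesis using x by auto
qed

lemma clinear_span_eq:
  assumes f: "clinear_on UNIV UNIV f" and g: "clinear_on UNIV UNIV g"
    and S: "\<And>x. x \<in> S \<Longrightarrow> f x = g x" and x: "x \<in> complex_vector.span S"
  shows "f x = g x"
proof -
  have "clinear_on UNIV UNIV (\<lambda>x. f x - g x)"
    using f g by (simp add: clinear_on_UNIV complex_vector.scale_right_diff_distrib)
  moreover have "complex_vector.subspace {0}"
    by (simp add: complex_vector.subspace_def)
  ultimately have "f x - g x \<in> {0}"
    using S x by (rule_tac clinear_span_mapsto) auto
  then show ?thesis by simp
qed

lemma clinear_on_subset:
  assumes "clinear_on UNIV UNIV h" "complex_vector.subspace S" "complex_vector.subspace T" "h ` S \<subseteq> T"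
  shows "clinear_on S T h"
  using assms by (auto simp: clinear_on_def)

lemma sum_const_scaleC: "(\<Sum>k<n. x) = of_nat n *\<^sub>C (x :: 'a::complex_vector)"
  by (induction n) (simp_all del: sum_constant add: scaleC_add_left scaleC_one add.commute)

lemma span_mult_closed:
  fixes S :: "'a::complex_algebra_1 set"
  assumes S: "\<And>x y. x \<in> S \<Longrightarrow> y \<in> S \<Longrightarrow> x * y \<in> complex_vector.span S"
    and x: "x \<in> complex_vector.span S" and y: "y \<in> complex_vector.span S"
  shows "x * y \<in> complex_vector.span S"
proof (rule clinear_span_mapsto[OF _ complex_vector.subspace_span _ x])
  show "clinear_on UNIV UNIV (\<lambda>x. x * y)"
    by (simp add: clinear_on_UNIV distrib_right mult_scaleC_left)
next
  fix x assume "x \<in> S"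
  show "x * y \<in> complex_vector.span S"
  proof (rule clinear_span_mapsto[OF _ complex_vector.subspace_span _ y])
    show "clinear_on UNIV UNIV (\<lambda>y. x * y)"
      by (simp add: clinear_on_UNIV distrib_left mult_scaleC_right)
  qed (rule S[OF \<open>x \<in> S\<close>])
qed

section \<open>Alternating monomials\<close>

text \<open>\<open>t_prod t [c\<^sub>1, \<dots>, c\<^sub>n] = t c\<^sub>1 t c\<^sub>2 \<cdots> t c\<^sub>n\<close>; unlike \<open>alt_monomial\<close>, it turns concatenation into products.\<close>

definition t_prod :: "'a::monoid_mult \<Rightarrow> 'a list \<Rightarrow> 'a" where
  "t_prod t cs = prod_list (map ((*) t) cs)"

lemma t_prod_simps [simp]:
  "t_prod t [] = 1" "t_prod t (c # cs) = t * c * t_prod t cs"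
  "t_prod t (cs @ ds) = t_prod t cs * t_prod t ds"
  by (simp_all add: t_prod_def)

lemma alt_monomial_Cons: "alt_monomial t (c # cs) = c * t_prod t cs"
  by (induction cs arbitrary: c) (simp_all add: mult.assoc)

lemma t_times_alt_monomial: "cs \<noteq> [] \<Longrightarrow> t * alt_monomial t cs = t_prod t cs"
  by (cases cs) (simp_all add: alt_monomial_Cons mult.assoc)

lemma alt_monomial_mult:
  fixes t :: "'a::monoid_mult"
  shows "alt_monomial t (cs @ [a]) * alt_monomial t (b # ds) = alt_monomial t (cs @ [a * b] @ ds)"
  by (cases cs) (simp_all add: alt_monomial_Cons mult.assoc)

lemma sum_rotate_shift:
  "(\<Sum>k<length xs. f (rotate (Suc k) xs)) = (\<Sum>k<length xs. (f (rotate k xs) :: 'a::ab_group_add))"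
proof -
  have "(\<Sum>k<Suc (length xs). f (rotate k xs)) = f (rotate 0 xs) + (\<Sum>k<length xs. f (rotate (Suc k) xs))"
    by (rule sum.lessThan_Suc_shift)
  then show ?thesis by (simp add: add.commute)
qed

lemma rotate_in_lists: "rotate k cs \<in> lists A \<longleftrightarrow> cs \<in> lists A"
  by (simp add: in_lists_conv_set)

section \<open>Grading\<close>

text \<open>A continuous functional \<open>\<theta>\<close> with \<open>\<theta>(1) = 1\<close>, the reference complement of \<open>{\<phi>. \<phi>(1) = 0}\<close>.\<close>

locale unital_functional =
  fixes \<theta> :: "'b::complex_banach_algebra_1 \<Rightarrow> complex"
  assumes \<theta>: "\<theta> \<in> cdual" and \<theta>1: "\<theta> 1 = 1"
begin

abbreviation (input) "t \<equiv> zgen \<theta>"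
abbreviation (input) "\<C> \<equiv> Z_one_perp :: 'b matfam set"

text \<open>The homogeneous elements of degree \<open>n\<close> in \<open>t\<close>, with coefficients in \<open>Z_one_perp\<close>.\<close>

definition hom_part :: "nat \<Rightarrow> 'b matfam set" where
  "hom_part n = complex_vector.span {alt_monomial t cs | cs. cs \<in> lists \<C> \<and> length cs = Suc n}"

lemma subspace_hom_part: "complex_vector.subspace (hom_part n)"
  by (simp add: hom_part_def)

lemma alt_monomial_in_hom_part: "cs \<in> lists \<C> \<Longrightarrow> length cs = Suc n \<Longrightarrow> alt_monomial t cs \<in> hom_part n"
  unfolding hom_part_def by (rule complex_vector.span_base) auto

lemma t_prod_in_Z_dual: "cs \<in> lists \<C> \<Longrightarrow> t_prod t cs \<in> Z_dual"
  using Z_one_perp_subset_Z_dual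
  by (induction cs) (auto intro!: csubalgebraD[OF csubalgebra_Z_dual] zgen_in_Z_dual \<theta>)

lemma alt_monomial_in_Z_dual: "cs \<in> lists \<C> \<Longrightarrow> alt_monomial t cs \<in> Z_dual"
  using Z_one_perp_subset_Z_dual
  by (cases cs) (auto simp: alt_monomial_Cons intro!: csubalgebraD[OF csubalgebra_Z_dual] t_prod_in_Z_dual)

lemma hom_part_subset_Z_dual: "hom_part n \<subseteq> Z_dual"
  unfolding hom_part_def
  by (intro complex_vector.span_minimal csubalgebraD[OF csubalgebra_Z_dual]) (auto intro: alt_monomial_in_Z_dual)

lemma hom_part_0: "hom_part 0 = \<C>"
proof
  show "hom_part 0 \<subseteq> \<C>"
    unfolding hom_part_def
    by (intro complex_vector.span_minimal csubalgebraD[OF csubalgebra_Z_one_perp]) (auto simp: length_Suc_conv)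
  show "\<C> \<subseteq> hom_part 0"
    using alt_monomial_in_hom_part[of "[_]" 0] by auto
qed

text \<open>
  The product of two monomials is a monomial because \<open>Z_one_perp\<close> is closed under products, and each
  generator \<open>zgen \<phi>\<close> is \<open>zgen (\<phi> - \<phi>(1)\<theta>) + \<phi>(1) t\<close>.
\<close>

lemma Z_dual_eq_span: "Z_dual = complex_vector.span {alt_monomial t cs | cs. cs \<in> lists \<C> \<and> cs \<noteq> []}"
  (is "_ = complex_vector.span ?S")
proof
  show "complex_vector.span ?S \<subseteq> Z_dual"
    by (intro complex_vector.span_minimal csubalgebraD[OF csubalgebra_Z_dual]) (auto intro: alt_monomial_in_Z_dual)
  have base: "alt_monomial t cs \<in> complex_vector.span ?S" if "cs \<in> lists \<C>" "cs \<noteq> []" for cs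
    using that by (intro complex_vector.span_base) auto
  note C = csubalgebraD[OF csubalgebra_Z_one_perp]
  have mult: "x * y \<in> complex_vector.span ?S" if xy: "x \<in> ?S" "y \<in> ?S" for x y
  proof -
    obtain cs ds where "x = alt_monomial t cs" "cs \<in> lists \<C>" "cs \<noteq> []"
        "y = alt_monomial t ds" "ds \<in> lists \<C>" "ds \<noteq> []"
      using xy by blast
    moreover from this obtain cs' a b ds' where "cs = cs' @ [a]" "ds = b # ds'"
      by (metis list.exhaust rev_exhaust)
    ultimately show ?thesis
      using base[of "cs' @ [a * b] @ ds'"] C(4)[of a b] by (simp add: alt_monomial_mult)
  qed
  show "Z_dual \<subseteq> complex_vector.span ?S"
  proof (rule Z_dual_subset)
    show "csubalgebra (complex_vector.span ?S)"
      unfolding csubalgebra_def using base[of "[1]"] C(2) span_mult_closed[OF mult] by simp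
    fix \<phi> :: "'b \<Rightarrow> complex" assume \<phi>: "\<phi> \<in> cdual"
    define \<psi> where "\<psi> = (\<lambda>x. \<phi> x - \<phi> 1 * \<theta> x)"
    have "\<psi> \<in> cdual"
      using \<phi> \<theta> unfolding \<psi>_def cdual_def
      by (auto intro!: bounded_linear_sub bounded_linear_const_mult simp: algebra_simps)
    moreover have "\<psi> 1 = 0" by (simp add: \<psi>_def \<theta>1)
    ultimately have "zgen \<psi> \<in> complex_vector.span ?S"
      using base[of "[zgen \<psi>]"] zgen_in_Z_one_perp[of \<psi>] by simp
    moreover have "t \<in> complex_vector.span ?S"
      using base[of "[1, 1]"] C(2) by simp
    moreover have "zgen \<phi> = zgen \<psi> + \<phi> 1 *\<^sub>C t"
      by (rule matfam_eqI, rule eq_matI) (auto simp: zgen.rep_eq fam_app_simps \<psi>_def)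
    ultimately show "zgen \<phi> \<in> complex_vector.span ?S"
      by (simp add: complex_vector.span_add complex_vector.span_scale)
  qed
qed

text \<open>
  The bound \<open>Suc M\<close> makes sure that the summand of degree \<open>0\<close> is present.
\<close>

lemma Z_dual_decomp:
  assumes "f \<in> Z_dual"
  obtains M g where "\<And>n. g n \<in> hom_part n" "f = (\<Sum>n<Suc M. g n)"
proof -
  let ?P = "\<lambda>f M. \<exists>g. (\<forall>n. g n \<in> hom_part n) \<and> f = (\<Sum>n<M. g n)"
  note sub = complex_vector.subspace_0[OF subspace_hom_part] complex_vector.subspace_add[OF subspace_hom_part]
    complex_vector.subspace_scale[OF subspace_hom_part]
  \<comment> \<open>Requiring every large number of summands makes the property closed under addition.\<close>
  have "Z_dual \<subseteq> {f. \<exists>N. \<forall>M\<ge>N. ?P f M}"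
    unfolding Z_dual_eq_span
  proof (rule complex_vector.span_minimal)
    show "complex_vector.subspace {f. \<exists>N. \<forall>M\<ge>N. ?P f M}"
      unfolding complex_vector.subspace_def mem_Collect_eq
    proof (intro conjI ballI allI)
      show "\<exists>N. \<forall>M\<ge>N. ?P 0 M"
        using sub by (intro exI[of _ 0] allI impI exI[of _ "\<lambda>_. 0"]) auto
    next
      fix f h assume "f \<in> {f. \<exists>N. \<forall>M\<ge>N. ?P f M}" "h \<in> {f. \<exists>N. \<forall>M\<ge>N. ?P f M}"
      then obtain N N' where N: "\<And>M. M \<ge> N \<Longrightarrow> ?P f M" "\<And>M. M \<ge> N' \<Longrightarrow> ?P h M" by auto
      show "\<exists>N. \<forall>M\<ge>N. ?P (f + h) M"
      proof (intro exI[of _ "max N N'"] allI impI)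
        fix M assume "max N N' \<le> M"
        then obtain g g' where "\<forall>n. g n \<in> hom_part n" "f = (\<Sum>n<M. g n)"
            "\<forall>n. g' n \<in> hom_part n" "h = (\<Sum>n<M. g' n)"
          using N[of M] by auto
        then show "?P (f + h) M"
          using sub by (intro exI[of _ "\<lambda>n. g n + g' n"]) (auto simp: sum.distrib)
      qed
    next
      fix c f assume "f \<in> {f. \<exists>N. \<forall>M\<ge>N. ?P f M}"
      then obtain N where N: "\<And>M. M \<ge> N \<Longrightarrow> ?P f M" by auto
      show "\<exists>N. \<forall>M\<ge>N. ?P (c *\<^sub>C f) M"
      proof (intro exI[of _ N] allI impI)
        fix M assume "N \<le> M"
        then obtain g where "\<forall>n. g n \<in> hom_part n" "f = (\<Sum>n<M. g n)"
          using N[of M] by auto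
        then show "?P (c *\<^sub>C f) M"
          using sub by (intro exI[of _ "\<lambda>n. c *\<^sub>C g n"]) (auto simp: complex_vector.scale_sum_right)
      qed
    qed
    show "{alt_monomial t cs |cs. cs \<in> lists \<C> \<and> cs \<noteq> []} \<subseteq> {f. \<exists>N. \<forall>M\<ge>N. ?P f M}"
    proof (rule subsetI, rule CollectI)
      fix f assume "f \<in> {alt_monomial t cs |cs. cs \<in> lists \<C> \<and> cs \<noteq> []}"
      then obtain cs where f: "f = alt_monomial t cs" and cs: "cs \<in> lists \<C>" "cs \<noteq> []" by auto
      then obtain k where k: "length cs = Suc k" by (cases cs) auto
      show "\<exists>N. \<forall>M\<ge>N. ?P f M"
        unfolding f using sub alt_monomial_in_hom_part[OF cs(1) k]
        by (intro exI[of _ "Suc k"] allI impI exI[of _ "\<lambda>n. if n = k then alt_monomial t cs else 0"]) auto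
    qed
  qed
  then have "f \<in> {f. \<exists>N. \<forall>M\<ge>N. ?P f M}" using assms by (rule subsetD)
  then obtain N where "\<forall>M\<ge>N. ?P f M" unfolding mem_Collect_eq by (rule exE)
  then have "?P f (Suc N)" by (simp del: sum.lessThan_Suc)
  then show ?thesis using that by blast
qed

lemma clinear_dilate: "clinear_on UNIV UNIV (dilate \<theta> \<mu>)"
  by (simp add: clinear_on_UNIV dilate_add dilate_scaleC)

lemma dilate_t: "dilate \<theta> \<mu> t = \<mu> *\<^sub>C t"
  using complex_vector.scale_left_distrib[of 1 "\<mu> - 1" t] by (simp add: dilate_zgen[OF \<theta>] \<theta>1)

lemma dilate_t_prod: "cs \<in> lists \<C> \<Longrightarrow> dilate \<theta> \<mu> (t_prod t cs) = \<mu> ^ length cs *\<^sub>C t_prod t cs"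
  by (induction cs) (auto simp: dilate_mult dilate_t dilate_Z_one_perp mult_scaleC_left mult_scaleC_right)

lemma dilate_hom_part:
  assumes "f \<in> hom_part n"
  shows "dilate \<theta> \<mu> f = \<mu> ^ n *\<^sub>C f"
proof (rule clinear_span_eq[OF clinear_dilate _ _ assms[unfolded hom_part_def]])
  show "clinear_on UNIV UNIV (\<lambda>f :: 'b matfam. \<mu> ^ n *\<^sub>C f)"
    by (simp add: clinear_on_UNIV scaleC_add_right mult.commute)
  show "dilate \<theta> \<mu> x = \<mu> ^ n *\<^sub>C x" if "x \<in> {alt_monomial t cs | cs. cs \<in> lists \<C> \<and> length cs = Suc n}" for x
    using that by (auto simp: length_Suc_conv alt_monomial_Cons dilate_mult dilate_Z_one_perp
        dilate_t_prod[unfolded in_lists_conv_set] mult_scaleC_right)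
qed

text \<open>
  Homogeneous elements of different degrees are independent: dilating \<open>\<Sum> g\<^sub>n = 0\<close> gives
  \<open>\<Sum> \<mu>\<^sup>n g\<^sub>n = 0\<close> for all \<open>\<mu>\<close>, a polynomial identity in each matrix entry.
\<close>

lemma hom_part_independent:
  assumes g: "\<And>n. g n \<in> hom_part n" and sum0: "(\<Sum>n<M. g n) = 0" and n: "n < M"
  shows "g n = 0"
proof (rule matfam_eqI, rule eq_matI)
  fix m \<beta> i j assume "i < dim_row (fam_app (0 :: 'b matfam) m \<beta>)" "j < dim_col (fam_app (0 :: 'b matfam) m \<beta>)"
  then have ij: "i < m" "j < m" by auto
  have entry: "fam_app (\<Sum>n\<in>A. h n) m \<beta> $$ (i, j) = (\<Sum>n\<in>A. fam_app (h n) m \<beta> $$ (i, j))"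
    for A :: "nat set" and h
    by (induction A rule: infinite_finite_induct) (use ij in \<open>simp_all add: fam_app_simps\<close>)
  have "(\<Sum>n<M. \<mu> ^ n *\<^sub>C g n) = 0" for \<mu>
    using arg_cong[OF sum0, of "dilate \<theta> \<mu>"]
    by (simp add: clinear_UNIV_sum[OF clinear_dilate] dilate_hom_part[OF g] clinear_UNIV_diff(1)[OF clinear_dilate])
  from this[THEN arg_cong, of "\<lambda>f. fam_app f m \<beta> $$ (i, j)"]
  have "(\<Sum>n<M. fam_app (g n) m \<beta> $$ (i, j) * \<mu> ^ n) = 0" for \<mu>
    unfolding entry using ij by (simp add: fam_app_simps mult.commute)
  then have "\<forall>n\<le>M - 1. fam_app (g n) m \<beta> $$ (i, j) = 0"
    using n by (subst polyfun_eq_0[symmetric]) (simp flip: lessThan_Suc_atMost)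
  then show "fam_app (g n) m \<beta> $$ (i, j) = fam_app 0 m \<beta> $$ (i, j)"
    using n ij by (simp add: fam_app_simps)
qed simp_all

section \<open>The cyclic derivative and the rotation on monomials\<close>

lemma clinear_twisted_deriv: "clinear_on UNIV UNIV (\<lambda>f. twisted_deriv \<theta> \<mu> f h)"
  by (simp add: clinear_on_UNIV twisted_deriv_add twisted_deriv_scaleC)

lemma twisted_deriv_product:
  "f \<in> Z_dual \<Longrightarrow> g \<in> Z_dual \<Longrightarrow> twisted_deriv \<theta> \<mu> (f * g) h
    = twisted_deriv \<theta> \<mu> f (g * h) + twisted_deriv \<theta> \<mu> g (h * dilate \<theta> \<mu> f)"
  using Z_dual_block_triangular by (intro twisted_deriv_mult) auto

lemma twisted_deriv_Z_one_perp:
  assumes "c \<in> \<C>"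
  shows "twisted_deriv \<theta> \<mu> c h = 0"
proof -
  have "\<C> \<subseteq> {f \<in> Z_dual. \<forall>h. twisted_deriv \<theta> \<mu> f h = 0}"
    by (intro Z_one_perp_subset csubalgebraI)
      (auto simp: twisted_deriv_add twisted_deriv_scaled_one twisted_deriv_product twisted_deriv_zgen
        intro: csubalgebraD[OF csubalgebra_Z_dual] zgen_in_Z_dual)
  then show ?thesis using assms by auto
qed

text \<open>
  Peeling off the first factor \<open>t c\<close>, which reappears, multiplied by \<open>\<mu>\<close>, at the end of the second
  argument.  For \<open>\<mu> = 1\<close> iteration yields all rotations; for \<open>\<mu> = 0\<close> only the first term survives.
\<close>

lemma twisted_deriv_t_prod_Cons:
  assumes "c \<in> \<C>" "cs \<in> lists \<C>"
  shows "twisted_deriv \<theta> \<mu> (t_prod t (c # cs)) h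
    = c * t_prod t cs * h + twisted_deriv \<theta> \<mu> (t_prod t cs) (\<mu> *\<^sub>C (h * t * c))"
proof -
  have c: "c \<in> Z_dual" and p: "t_prod t cs \<in> Z_dual" and t: "t \<in> Z_dual"
    using assms Z_one_perp_subset_Z_dual t_prod_in_Z_dual zgen_in_Z_dual[OF \<theta>] by auto
  have cp: "c * t_prod t cs \<in> Z_dual"
    using c p by (rule csubalgebraD(4)[OF csubalgebra_Z_dual])
  show ?thesis
    using assms
    by (simp add: twisted_deriv_product[OF t cp] twisted_deriv_product[OF c p]
        twisted_deriv_Z_one_perp twisted_deriv_zgen[OF \<theta>] \<theta>1 dilate_mult dilate_t dilate_Z_one_perp
        mult_scaleC_left mult_scaleC_right mult.assoc)
qed

lemma twisted_deriv_1_t_prod: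
  assumes "cs \<in> lists \<C>" "ds \<in> lists \<C>"
  shows "twisted_deriv \<theta> 1 (t_prod t cs) (t_prod t ds) = (\<Sum>k<length cs. alt_monomial t (rotate k (cs @ ds)))"
  using assms
proof (induction cs arbitrary: ds)
  case Nil
  then show ?case using twisted_deriv_scaled_one[of \<theta> 1 1] by simp
next
  case (Cons c cs)
  then have c: "c \<in> \<C>" "cs \<in> lists \<C>" "ds @ [c] \<in> lists \<C>" by auto
  have "twisted_deriv \<theta> 1 (t_prod t (c # cs)) (t_prod t ds)
      = alt_monomial t (c # cs @ ds) + twisted_deriv \<theta> 1 (t_prod t cs) (t_prod t (ds @ [c]))"
    unfolding twisted_deriv_t_prod_Cons[OF c(1,2)] by (simp add: alt_monomial_Cons mult.assoc)
  also have "\<dots> = alt_monomial t (c # cs @ ds) + (\<Sum>k<length cs. alt_monomial t (rotate k (cs @ ds @ [c])))"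
    by (simp only: Cons.IH[OF c(3)] append_assoc)
  also have "\<dots> = (\<Sum>k<length (c # cs). alt_monomial t (rotate k ((c # cs) @ ds)))"
    by (simp add: sum.lessThan_Suc_shift rotate1_rotate_swap del: sum.lessThan_Suc)
  finally show ?case .
qed

abbreviation (input) "der f \<equiv> twisted_deriv \<theta> 1 f 1"

lemma cyc_deriv_Z_dual: "f \<in> Z_dual \<Longrightarrow> cyc_deriv f = der f"
  using Z_dual_block_triangular cyc_deriv_eq_twisted_deriv by auto

lemma der_mult_comm: "f \<in> Z_dual \<Longrightarrow> g \<in> Z_dual \<Longrightarrow> der (f * g) = der (g * f)"
  by (simp add: twisted_deriv_product add.commute)

lemma der_t_prod: "cs \<in> lists \<C> \<Longrightarrow> der (t_prod t cs) = (\<Sum>k<length cs. alt_monomial t (rotate k cs))"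
  using twisted_deriv_1_t_prod[of cs "[]"] by simp

text \<open>
  The linear map on all families that extends \<open>\<rho>\<close>.  The summand \<open>dilate \<theta> 0 f\<close> is the part of degree
  \<open>0\<close>, which the first summand annihilates.
\<close>

definition rot :: "'b matfam \<Rightarrow> 'b matfam" where
  "rot f = twisted_deriv \<theta> 0 f t + dilate \<theta> 0 f"

lemma clinear_rot: "clinear_on UNIV UNIV rot"
  by (simp add: clinear_on_UNIV rot_def twisted_deriv_add twisted_deriv_scaleC dilate_add dilate_scaleC
      scaleC_add_right)

lemma rot_alt_monomial:
  assumes "c \<in> \<C>" "cs \<in> lists \<C>"
  shows "rot (alt_monomial t (c # cs)) = alt_monomial t (cs @ [c])"
proof -
  have c: "c \<in> Z_dual" using assms Z_one_perp_subset_Z_dual by auto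
  have *: "twisted_deriv \<theta> 0 (c * t_prod t cs) t = twisted_deriv \<theta> 0 (t_prod t cs) (t * c)"
    by (simp add: twisted_deriv_product[OF c t_prod_in_Z_dual[OF assms(2)]] twisted_deriv_Z_one_perp[OF assms(1)]
        dilate_Z_one_perp[OF assms(1)])
  show ?thesis
  proof (cases cs)
    case Nil
    then show ?thesis using twisted_deriv_Z_one_perp dilate_Z_one_perp assms by (simp add: rot_def)
  next
    case (Cons d ds)
    then have d: "d \<in> \<C>" "ds \<in> lists \<C>" using assms(2) by auto
    have "twisted_deriv \<theta> 0 (t_prod t cs) (t * c) = alt_monomial t (cs @ [c])"
      unfolding Cons twisted_deriv_t_prod_Cons[OF d]
      by (simp add: twisted_deriv_zero_right alt_monomial_Cons mult.assoc)
    moreover have "dilate \<theta> 0 (c * t_prod t cs) = 0"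
      by (simp only: dilate_mult dilate_t_prod[OF assms(2)]) (simp add: Cons)
    ultimately show ?thesis
      by (simp only: rot_def alt_monomial_Cons *) simp
  qed
qed

lemma rot_alt_monomial_rotate1:
  "cs \<in> lists \<C> \<Longrightarrow> cs \<noteq> [] \<Longrightarrow> rot (alt_monomial t cs) = alt_monomial t (rotate1 cs)"
  by (cases cs) (auto simp: rot_alt_monomial)

lemma rot_funpow_alt_monomial:
  "cs \<in> lists \<C> \<Longrightarrow> cs \<noteq> [] \<Longrightarrow> (rot ^^ k) (alt_monomial t cs) = alt_monomial t (rotate k cs)"
  by (induction k) (simp_all add: rot_alt_monomial_rotate1 rotate_in_lists)

lemma clinear_rot_funpow: "clinear_on UNIV UNIV (rot ^^ k)"
  using clinear_rot by (induction k) (simp_all add: clinear_on_UNIV)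

lemma rot_hom_part:
  assumes "f \<in> hom_part n"
  shows "rot f \<in> hom_part n"
proof (rule clinear_span_mapsto[OF clinear_rot subspace_hom_part _ assms[unfolded hom_part_def]])
  fix x assume "x \<in> {alt_monomial t cs |cs. cs \<in> lists \<C> \<and> length cs = Suc n}"
  then obtain cs where cs: "x = alt_monomial t cs" "cs \<in> lists \<C>" "length cs = Suc n" by auto
  then have ne: "cs \<noteq> []" by auto
  have "rotate1 cs \<in> lists \<C>" "length (rotate1 cs) = Suc n"
    using cs by (simp_all add: in_lists_conv_set)
  then show "rot x \<in> hom_part n"
    unfolding cs(1) rot_alt_monomial_rotate1[OF cs(2) ne] by (rule alt_monomial_in_hom_part)
qed

section \<open>Exactness\<close>

abbreviation (input) "Comm \<equiv> commutator_span (Z_dual :: 'b matfam set)"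

lemma subspace_Comm: "complex_vector.subspace Comm"
  by (simp add: commutator_span_def)

lemma commutator_in_Comm: "f \<in> Z_dual \<Longrightarrow> g \<in> Z_dual \<Longrightarrow> f * g - g * f \<in> Comm"
  unfolding commutator_span_def by (rule complex_vector.span_base) auto

lemma t_prod_rotate_diff_in_Comm:
  assumes "cs \<in> lists \<C>"
  shows "t_prod t (rotate k cs) - t_prod t cs \<in> Comm"
proof -
  let ?m = "k mod length cs"
  have "take ?m cs \<in> lists \<C>" "drop ?m cs \<in> lists \<C>"
    using assms by (auto simp: in_lists_conv_set dest: in_set_takeD in_set_dropD)
  then have "t_prod t (drop ?m cs) * t_prod t (take ?m cs) - t_prod t (take ?m cs) * t_prod t (drop ?m cs) \<in> Comm"
    by (intro commutator_in_Comm t_prod_in_Z_dual)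
  then show ?thesis
    by (simp add: rotate_drop_take flip: t_prod_simps(3))
qed

text \<open>
  Moving the first coefficient to the end changes a monomial by a commutator, so a monomial of
  positive degree may be assumed to start with \<open>t\<close>.  In degree \<open>0\<close> both derivatives vanish.
\<close>

lemma alt_monomial_normal_form:
  assumes "cs \<in> lists \<C>" "length cs = Suc n"
  obtains ds where "ds \<in> lists \<C>" "length ds = n"
    "der (alt_monomial t cs) = der (t_prod t ds)" "n > 0 \<Longrightarrow> t_prod t ds - alt_monomial t cs \<in> Comm"
proof (cases n)
  case 0
  then obtain c where "cs = [c]" using assms(2) by (auto simp: length_Suc_conv)
  then show ?thesis
    using that[of "[]"] assms(1) 0 twisted_deriv_Z_one_perp der_t_prod[of "[]"] by simp
next
  case (Suc m)
  then obtain c bs where "cs = c # bs" "length bs = Suc m" using assms(2) by (auto simp: length_Suc_conv)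
  then obtain as a where cs: "cs = c # as @ [a]" "length as = m"
    by (metis length_append_singleton nat.inject rev_exhaust list.size(3) nat.distinct(1))
  have mem: "c \<in> \<C>" "a \<in> \<C>" "as \<in> lists \<C>" "as @ [a] \<in> lists \<C>" using assms(1) cs by auto
  have c: "c \<in> Z_dual" using mem Z_one_perp_subset_Z_dual by auto
  have eq: "t_prod t (as @ [a * c]) = t_prod t (as @ [a]) * c" "alt_monomial t cs = c * t_prod t (as @ [a])"
    by (simp_all add: cs alt_monomial_Cons mult.assoc)
  show ?thesis
  proof (rule that[of "as @ [a * c]"])
    show "der (alt_monomial t cs) = der (t_prod t (as @ [a * c]))"
      unfolding eq by (rule der_mult_comm[OF c t_prod_in_Z_dual[OF mem(4)]])
    show "t_prod t (as @ [a * c]) - alt_monomial t cs \<in> Comm"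
      unfolding eq by (rule commutator_in_Comm[OF t_prod_in_Z_dual[OF mem(4)] c])
  qed (use mem cs Suc csubalgebraD(4)[OF csubalgebra_Z_one_perp] in auto)
qed

lemma der_hom_part:
  assumes "f \<in> hom_part n"
  shows "der f \<in> hom_part (n - 1)"
proof (rule clinear_span_mapsto[OF clinear_twisted_deriv subspace_hom_part _ assms[unfolded hom_part_def]])
  fix x assume "x \<in> {alt_monomial t cs |cs. cs \<in> lists \<C> \<and> length cs = Suc n}"
  then obtain cs where cs: "x = alt_monomial t cs" "cs \<in> lists \<C>" "length cs = Suc n" by auto
  obtain ds where ds: "ds \<in> lists \<C>" "length ds = n" "der x = der (t_prod t ds)"
    using alt_monomial_normal_form[OF cs(2,3)] cs(1) by blast
  have "alt_monomial t (rotate k ds) \<in> hom_part (n - 1)" if "k < n" for k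
    using that ds by (intro alt_monomial_in_hom_part) (auto simp: rotate_in_lists)
  then show "der x \<in> hom_part (n - 1)"
    unfolding ds(3) der_t_prod[OF ds(1)] ds(2) by (intro complex_vector.subspace_sum subspace_hom_part) auto
qed

lemma rot_der:
  assumes "f \<in> Z_dual"
  shows "rot (der f) = der f"
proof (rule clinear_span_eq[OF _ clinear_twisted_deriv _ assms[unfolded Z_dual_eq_span]])
  show "clinear_on UNIV UNIV (\<lambda>f. rot (der f))"
    using clinear_rot clinear_twisted_deriv by (simp add: clinear_on_UNIV)
  fix x assume "x \<in> {alt_monomial t cs |cs. cs \<in> lists \<C> \<and> cs \<noteq> []}"
  then obtain cs where cs: "x = alt_monomial t cs" "cs \<in> lists \<C>" "cs \<noteq> []" by blast
  then have len: "length cs = Suc (length cs - 1)" by simp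
  obtain ds where ds: "ds \<in> lists \<C>" "der x = der (t_prod t ds)"
    using alt_monomial_normal_form[OF cs(2) len] cs(1) by blast
  have "rot (alt_monomial t (rotate k ds)) = alt_monomial t (rotate (Suc k) ds)" if "k < length ds" for k
    using that ds(1) by (subst rot_alt_monomial_rotate1) (auto simp: rotate_in_lists)
  then have "rot (der x) = (\<Sum>k<length ds. alt_monomial t (rotate (Suc k) ds))"
    unfolding ds(2) der_t_prod[OF ds(1)] clinear_UNIV_sum[OF clinear_rot] by (intro sum.cong) auto
  then show "rot (der x) = der x"
    unfolding sum_rotate_shift ds(2) der_t_prod[OF ds(1)] .
qed

text \<open>
  In degree \<open>n\<close>, \<open>t D(f)\<close> agrees with \<open>n f\<close> up to commutators: each of the \<open>n\<close> rotations, multiplied by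
  \<open>t\<close>, is a cyclic permutation of \<open>f\<close>.
\<close>

lemma t_mult_der_diff_in_Comm:
  assumes "f \<in> hom_part n"
  shows "t * der f - of_nat n *\<^sub>C f \<in> Comm"
proof (rule clinear_span_mapsto[OF _ subspace_Comm _ assms[unfolded hom_part_def]])
  show "clinear_on UNIV UNIV (\<lambda>f. t * der f - of_nat n *\<^sub>C f)"
    by (simp add: clinear_on_UNIV twisted_deriv_add twisted_deriv_scaleC distrib_left mult_scaleC_right
        complex_vector.scale_right_diff_distrib scaleC_add_right mult.commute)
  fix x assume "x \<in> {alt_monomial t cs |cs. cs \<in> lists \<C> \<and> length cs = Suc n}"
  then obtain cs where cs: "x = alt_monomial t cs" "cs \<in> lists \<C>" "length cs = Suc n" by auto
  obtain ds where ds: "ds \<in> lists \<C>" "length ds = n" "der x = der (t_prod t ds)"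
    "n > 0 \<Longrightarrow> t_prod t ds - x \<in> Comm"
    using alt_monomial_normal_form[OF cs(2,3)] cs(1) by blast
  have "t * der x = (\<Sum>k<n. t_prod t (rotate k ds))"
    unfolding ds(3) der_t_prod[OF ds(1)] ds(2) sum_distrib_left
    using ds(2) by (intro sum.cong refl t_times_alt_monomial) auto
  moreover have "of_nat n *\<^sub>C x = (\<Sum>k<n. x)"
    by (rule sum_const_scaleC[symmetric])
  ultimately have "t * der x - of_nat n *\<^sub>C x = (\<Sum>k<n. (t_prod t (rotate k ds) - t_prod t ds) + (t_prod t ds - x))"
    by (simp add: sum_subtractf)
  also have "\<dots> \<in> Comm"
    using ds t_prod_rotate_diff_in_Comm[OF ds(1)]
    by (intro complex_vector.subspace_sum complex_vector.subspace_add subspace_Comm) auto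
  finally show "t * der x - of_nat n *\<^sub>C x \<in> Comm" .
qed

lemma der_t_mult:
  assumes "f \<in> hom_part n"
  shows "der (t * f) = (\<Sum>k<Suc n. (rot ^^ k) f)"
proof (rule clinear_span_eq[OF _ _ _ assms[unfolded hom_part_def]])
  show "clinear_on UNIV UNIV (\<lambda>f. der (t * f))"
    by (simp add: clinear_on_UNIV twisted_deriv_add twisted_deriv_scaleC distrib_left mult_scaleC_right)
  show "clinear_on UNIV UNIV (\<lambda>f. \<Sum>k<Suc n. (rot ^^ k) f)"
    using clinear_rot_funpow by (simp add: clinear_on_UNIV sum.distrib complex_vector.scale_sum_right del: sum.lessThan_Suc)
  fix x assume "x \<in> {alt_monomial t cs |cs. cs \<in> lists \<C> \<and> length cs = Suc n}"
  then obtain cs where cs: "x = alt_monomial t cs" "cs \<in> lists \<C>" "length cs = Suc n" by auto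
  then have "cs \<noteq> []" by auto
  then show "der (t * x) = (\<Sum>k<Suc n. (rot ^^ k) x)"
    using cs by (simp add: t_times_alt_monomial der_t_prod rot_funpow_alt_monomial del: sum.lessThan_Suc)
qed

lemma der_in_Z_dual:
  assumes "f \<in> Z_dual"
  shows "der f \<in> Z_dual"
proof -
  obtain M g where g: "\<And>n. g n \<in> hom_part n" "f = (\<Sum>n<Suc M. g n)"
    using Z_dual_decomp[OF assms] by blast
  have "der (g n) \<in> Z_dual" for n
    using der_hom_part[OF g(1)[of n]] hom_part_subset_Z_dual by auto
  then show ?thesis
    unfolding g(2) clinear_UNIV_sum[OF clinear_twisted_deriv]
    by (intro complex_vector.subspace_sum csubalgebraD(1)[OF csubalgebra_Z_dual])
qed

lemma rot_in_Z_dual: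
  assumes "f \<in> Z_dual"
  shows "rot f \<in> Z_dual"
proof -
  obtain M g where g: "\<And>n. g n \<in> hom_part n" "f = (\<Sum>n<Suc M. g n)"
    using Z_dual_decomp[OF assms] by blast
  have "rot (g n) \<in> Z_dual" for n
    using rot_hom_part[OF g(1)[of n]] hom_part_subset_Z_dual by auto
  then show ?thesis
    unfolding g(2) clinear_UNIV_sum[OF clinear_rot]
    by (intro complex_vector.subspace_sum csubalgebraD(1)[OF csubalgebra_Z_dual])
qed

lemma commutator_span_subset_Z_dual: "Comm \<subseteq> Z_dual"
  unfolding commutator_span_def
  by (intro complex_vector.span_minimal csubalgebraD(1)[OF csubalgebra_Z_dual])
    (auto intro!: csubalgebraD[OF csubalgebra_Z_dual])

lemma der_Comm:
  assumes "f \<in> Comm"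
  shows "der f = 0"
proof -
  have "der f \<in> {0}"
    by (rule clinear_span_mapsto[OF clinear_twisted_deriv _ _ assms[unfolded commutator_span_def]])
      (auto simp: complex_vector.subspace_def clinear_UNIV_diff(2)[OF clinear_twisted_deriv] der_mult_comm)
  then show ?thesis by simp
qed

text \<open>
  If \<open>D f = 0\<close>, then \<open>D\<close> annihilates each homogeneous part of \<open>f\<close>, because it lowers the degree by
  one; the parts of positive degree are therefore sums of commutators.
\<close>

lemma der_kernel:
  assumes f: "f \<in> Z_dual" and der0: "der f = 0"
  obtains x y where "x \<in> \<C>" "y \<in> Comm" "f = x + y"
proof -
  obtain M g where g: "\<And>n. g n \<in> hom_part n" "f = (\<Sum>n<Suc M. g n)"
    using Z_dual_decomp[OF f] by blast
  have f_eq: "f = g 0 + (\<Sum>n<M. g (Suc n))"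
    unfolding g(2) by (rule sum.lessThan_Suc_shift)
  have g0: "g 0 \<in> \<C>" using g(1)[of 0] hom_part_0 by simp
  have "(\<Sum>n<M. der (g (Suc n))) = 0"
    using der0 twisted_deriv_Z_one_perp[OF g0]
    by (simp add: f_eq twisted_deriv_add clinear_UNIV_sum[OF clinear_twisted_deriv])
  then have 0: "der (g (Suc n)) = 0" if "n < M" for n
    using that der_hom_part[OF g(1), of "Suc _"] by (intro hom_part_independent[where g = "\<lambda>n. der (g (Suc n))"]) auto
  have "g (Suc n) \<in> Comm" if "n < M" for n
  proof -
    have "- (of_nat (Suc n) *\<^sub>C g (Suc n)) \<in> Comm"
      using t_mult_der_diff_in_Comm[OF g(1)[of "Suc n"]] 0[OF that] by simp
    from complex_vector.subspace_scale[OF subspace_Comm this, of "- 1 / of_nat (Suc n)"]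
    show ?thesis by (simp del: of_nat_Suc)
  qed
  then have "(\<Sum>n<M. g (Suc n)) \<in> Comm"
    by (intro complex_vector.subspace_sum subspace_Comm) auto
  then show ?thesis using that g0 f_eq by blast
qed

text \<open>
  If \<open>\<rho> f = f\<close>, then \<open>\<rho>\<close> fixes each homogeneous part \<open>g\<^sub>n\<close>, and \<open>g\<^sub>n = D(t g\<^sub>n) / (n + 1)\<close>.
\<close>

lemma rot_fixed_in_der_image:
  assumes f: "f \<in> Z_dual" and fixed: "rot f = f"
  shows "f \<in> der ` Z_dual"
proof -
  obtain M g where g: "\<And>n. g n \<in> hom_part n" "f = (\<Sum>n<Suc M. g n)"
    using Z_dual_decomp[OF f] by blast
  have "(\<Sum>n<Suc M. rot (g n) - g n) = 0"
    using fixed by (simp only: g(2) sum_subtractf clinear_UNIV_sum[OF clinear_rot] diff_self)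
  moreover have "rot (g n) - g n \<in> hom_part n" for n
    by (intro complex_vector.subspace_diff subspace_hom_part rot_hom_part g)
  ultimately have rot: "rot (g n) = g n" if "n < Suc M" for n
    using hom_part_independent[of "\<lambda>n. rot (g n) - g n" "Suc M" n] that by simp
  let ?h = "\<lambda>n. (1 / of_nat (Suc n)) *\<^sub>C (t * g n)"
  have "der (?h n) = g n" if n: "n < Suc M" for n
  proof -
    have "(rot ^^ k) (g n) = g n" for k
      by (induction k) (simp_all add: rot[OF n])
    then have "der (t * g n) = of_nat (Suc n) *\<^sub>C g n"
      unfolding der_t_mult[OF g(1)] by (simp only: sum_const_scaleC)
    then show ?thesis by (simp add: twisted_deriv_scaleC del: of_nat_Suc)
  qed
  then have "f = der (\<Sum>n<Suc M. ?h n)"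
    unfolding g(2) clinear_UNIV_sum[OF clinear_twisted_deriv] by (intro sum.cong) auto
  moreover have "(\<Sum>n<Suc M. ?h n) \<in> Z_dual"
    using g(1) hom_part_subset_Z_dual
    by (intro complex_vector.subspace_sum csubalgebraD[OF csubalgebra_Z_dual] zgen_in_Z_dual[OF \<theta>]) auto
  ultimately show ?thesis by blast
qed

text \<open>
  The map \<open>rot\<close> witnesses that \<open>\<rho>\<close> exists; it is unique because the monomials span \<open>Z_dual\<close>.
\<close>

lemma rho_map_eq: "rho_map \<theta> = (\<lambda>f. if f \<in> Z_dual then rot f else 0)"
  unfolding rho_map_def
proof (rule the_equality, goal_cases)
  case 1
  have "clinear_on Z_dual Z_dual rot"
    using rot_in_Z_dual
    by (intro clinear_on_subset[OF clinear_rot] csubalgebraD(1)[OF csubalgebra_Z_dual]) auto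
  then have "clinear_on Z_dual Z_dual (\<lambda>f. if f \<in> Z_dual then rot f else 0)"
    by (simp add: clinear_on_def Pi_iff csubalgebraD(5,7)[OF csubalgebra_Z_dual])
  moreover have "alt_monomial t (c # cs) \<in> Z_dual" if "c \<in> \<C>" "cs \<in> lists \<C>" for c cs
    using that by (intro alt_monomial_in_Z_dual) simp
  ultimately show ?case
    by (simp add: rot_alt_monomial)
next
  case (2 \<rho>)
  then have lin: "clinear_on Z_dual Z_dual \<rho>" and out: "\<And>f. f \<notin> Z_dual \<Longrightarrow> \<rho> f = 0"
    and mono: "\<And>c cs. c \<in> \<C> \<Longrightarrow> cs \<in> lists \<C> \<Longrightarrow> \<rho> (alt_monomial t (c # cs)) = alt_monomial t (cs @ [c])"
    by auto
  note Z = csubalgebraD[OF csubalgebra_Z_dual[where 'a = 'b]]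
  have "complex_vector.subspace {f \<in> Z_dual. \<rho> f = rot f}"
    unfolding complex_vector.subspace_def
    using Z clinear_onD[OF lin] clinear_onD[OF clinear_rot] clinear_onD(3)[OF lin, of 0 0]
      clinear_UNIV_diff(1)[OF clinear_rot] by auto
  moreover have "{alt_monomial t cs |cs. cs \<in> lists \<C> \<and> cs \<noteq> []} \<subseteq> {f \<in> Z_dual. \<rho> f = rot f}"
  proof (rule subsetI, rule CollectI)
    fix f assume "f \<in> {alt_monomial t cs |cs. cs \<in> lists \<C> \<and> cs \<noteq> []}"
    then obtain cs where f: "f = alt_monomial t cs" and cs: "cs \<in> lists \<C>" "cs \<noteq> []" by auto
    then obtain d ds where "cs = d # ds" "d \<in> \<C>" "ds \<in> lists \<C>" by (cases cs) auto
    then show "f \<in> Z_dual \<and> \<rho> f = rot f"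
      unfolding f
      using mono rot_alt_monomial alt_monomial_in_Z_dual[OF cs(1)] by simp
  qed
  ultimately have "Z_dual \<subseteq> {f \<in> Z_dual. \<rho> f = rot f}"
    by (subst Z_dual_eq_span) (rule complex_vector.span_minimal)
  then have "\<rho> f = (if f \<in> Z_dual then rot f else 0)" for f
    using out[of f] by (cases "f \<in> Z_dual") auto
  then show ?case by (rule ext)
qed

end

theorem corollary9p7:
  fixes \<theta> :: "'b::complex_banach_algebra_1 \<Rightarrow> complex"
  assumes "\<theta> \<in> cdual" and "\<theta> 1 = 1"
  defines "N \<equiv> {x + y | x y. x \<in> Z_one_perp \<and> y \<in> commutator_span (Z_dual :: 'b matfam set)}"
  shows "clinear_on N Z_dual (\<lambda>f. f)
       \<and> clinear_on Z_dual Z_dual (cyc_deriv :: 'b matfam \<Rightarrow> 'b matfam)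
       \<and> clinear_on Z_dual Z_dual (Theta_map \<theta>)
       \<and> kernel_on N (\<lambda>f. f) = {0}
       \<and> (\<lambda>f. f) ` N = kernel_on Z_dual cyc_deriv
       \<and> cyc_deriv ` Z_dual = kernel_on Z_dual (Theta_map \<theta>)"
proof -
  interpret unital_functional \<theta>
    by unfold_locales (use assms in simp_all)
  let ?Z = "Z_dual :: 'b matfam set"
  let ?D = "\<lambda>f. twisted_deriv \<theta> 1 f 1"
  note Z = csubalgebraD[OF csubalgebra_Z_dual[where 'a = 'b]]
  have subN: "complex_vector.subspace N"
    unfolding N_def
    by (rule complex_vector.subspace_sums[OF csubalgebraD(1)[OF csubalgebra_Z_one_perp] subspace_Comm])
  have NZ: "N \<subseteq> ?Z"
    using Z_one_perp_subset_Z_dual commutator_span_subset_Z_dual Z(5) unfolding N_def by blast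
  have D: "cyc_deriv f = ?D f" if "f \<in> ?Z" for f
    using cyc_deriv_Z_dual[OF that] .
  have Theta: "Theta_map \<theta> f = f - rot f" if "f \<in> ?Z" for f
    using that by (simp add: Theta_map_def rho_map_eq)
  have "clinear_on N ?Z (\<lambda>f. f)"
    using subN NZ Z(1) by (auto simp: clinear_on_def)
  moreover have "clinear_on ?Z ?Z cyc_deriv"
    using der_in_Z_dual Z clinear_onD[OF clinear_twisted_deriv]
    by (auto simp: clinear_on_def D)
  moreover have "clinear_on ?Z ?Z (Theta_map \<theta>)"
    using rot_in_Z_dual Z clinear_onD[OF clinear_rot]
    by (auto simp: clinear_on_def Theta complex_vector.scale_right_diff_distrib)
  moreover have "kernel_on N (\<lambda>f. f) = {0}"
    using complex_vector.subspace_0[OF subN] by (auto simp: kernel_on_def)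
  moreover have "N = kernel_on ?Z cyc_deriv"
  proof (intro subset_antisym subsetI)
    fix f assume "f \<in> N"
    then obtain x y where xy: "f = x + y" "x \<in> Z_one_perp" "y \<in> commutator_span ?Z" by (auto simp: N_def)
    then have "?D f = 0"
      using twisted_deriv_Z_one_perp[OF xy(2)] der_Comm[OF xy(3)] by (simp add: twisted_deriv_add)
    then show "f \<in> kernel_on ?Z cyc_deriv"
      using \<open>f \<in> N\<close> NZ D by (auto simp: kernel_on_def)
  next
    fix f assume "f \<in> kernel_on ?Z cyc_deriv"
    then have f: "f \<in> ?Z" "?D f = 0" by (auto simp: kernel_on_def D)
    then show "f \<in> N" using der_kernel[OF f] unfolding N_def by blast
  qed
  moreover have "cyc_deriv ` ?Z = kernel_on ?Z (Theta_map \<theta>)"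
  proof (intro subset_antisym subsetI)
    fix f assume "f \<in> cyc_deriv ` ?Z"
    then obtain g where g: "g \<in> ?Z" "f = ?D g" by (auto simp: D)
    then show "f \<in> kernel_on ?Z (Theta_map \<theta>)"
      using der_in_Z_dual[OF g(1)] rot_der[OF g(1)] by (simp add: kernel_on_def Theta)
  next
    fix f assume "f \<in> kernel_on ?Z (Theta_map \<theta>)"
    then have f: "f \<in> ?Z" "rot f = f" by (auto simp: kernel_on_def Theta)
    then show "f \<in> cyc_deriv ` ?Z" using rot_fixed_in_der_image[OF f] D by force
  qed
  ultimately show ?thesis by simp
qed

end
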